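(* Let $w_0>0$. Assume that $U$ satisfies the utility assumption and that we are in the positive-wealth setting. Suppose there exist $S^*\in\mathscr S^{*}$ and, for each $t\in\{1,\ldots,T\}$, $\mathcal F_{t-1}$-measurable random variables $\beta_t>0$, $\kappa_t>0$ a.s. satisfying $$\operatorname*{ess\,inf}_{\xi\in\Xi_t^{S^*}}\mathbb P\big(\langle\xi,\Delta S^*_t\rangle\le-\beta_t\|\xi\|\,\big|\,\mathcal F_{t-1}\big)\ge\kappa_t\quad\text{a.s. on }\{D_t^{S^*}\neq\{0\}\},$$ where $\Xi_t^{S^*}=\{\xi\in L^0(\mathcal F_{t-1};\mathbb R^d):\xi\in D_t^{S^*}\text{ a.s.}\}$, such that $1/\beta_t\in\mathscr W$ for all $t$, and such that $\|\Delta S_t\|\in\mathscr W$ for all $S\in\mathscr S$ and all $t\in\{1,\ldots,T\}$. Then there exists $\hat\phi\in\mathcal A(w_0)$ such that $$u(w_0)=\inf_{S\in\mathscr S}\mathbb E_{\mathbb P}\big[U(W_T^S(w_0,\hat\phi))\big]<+\infty.$$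
   Context: Fix $d,T\in\mathbb N$ and a filtered probability space $(\Omega,\mathcal F,\mathbb F=(\mathcal F_t)_{t=0}^T,\mathbb P)$ whose $\sigma$-algebras all contain the $\mathbb P$-null sets; random variables equal a.s. are identified. For $\mathcal G\subseteq\mathcal F$, $L^0(\mathcal G;\mathbb R^n)$ is the space of $\mathcal G$-measurable $\mathbb R^n$-valued random variables with the topology of convergence in probability. Let $\mathscr S$ be a nonempty family of $\mathbb F$-adapted $\mathbb R^d$-valued processes $S=(S_t)_{t=0}^T$, and write $\Delta S_t=S_t-S_{t-1}$. Let $\mathscr L=\prod_{t=1}^T L^0(\mathcal F_{t-1};\mathbb R^d)$. For $w\in\mathbb R$, $\phi\in\mathscr L$, $S\in\mathscr S$, set $W_t^S(w,\phi)=w+\sum_{s=1}^t\langle\phi_s,\Delta S_s\rangle$. For $S\in\mathscr S$ and $t\ge1$, $D_t^S(\omega)$ is the smallest affine subspace of $\mathbb R^d$ containing the support of the regular conditional distribution of $\Delta S_t$ given $\mathcal F_{t-1}$ at $\omega$. NA($S$) means: for every $\phi\in\mathscr L$, $W_T^S(0,\phi)\ge0$ a.s. implies $W_T^S(0,\phi)=0$ a.s. $\mathscr S^{*}$ denotes the set of $S^*\in\mathscr S$ such that NA($S^*$) holds and, for every $S\in\mathscr S$ and $t$, $D_t^S\subseteq D_t^{S^*}$ a.s. $\mathscr W=\{X\in L^0(\mathcal F_T;\mathbb R):\mathbb E_{\mathbb P}[|X|^p]<\infty\text{ for all }p>0\}$. Utility assumption: $U:\mathbb R\to\mathbb R\cup\{-\infty\}$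 is non-decreasing, concave and upper semicontinuous. Positive-wealth setting: for every $S\in\mathscr S$, $\mathscr L(w_0,S)=\{\phi\in\mathscr L: W_t^S(w_0,\phi)\ge0\ \text{a.s. for all }t\in\{0,\ldots,T\}\}$, and the interior of $\{x:U(x)>-\infty\}$ is $(0,+\infty)$. Admissible set $\mathcal A(w_0)=\bigcap_{S\in\mathscr S}\mathscr L(w_0,S)$; value $u(w_0)=\sup_{\varphi\in\mathcal A(w_0)}\inf_{S\in\mathscr S}\mathbb E_{\mathbb P}[U(W_T^S(w_0,\varphi))]$, with the convention that the expectation of a random variable whose positive and negative parts both have infinite expectation is $-\infty$. *)

theory Defs
  imports "HOL-Analysis.Analysis" "HOL-Probability.Probability"
begin

definition filtered_prob_space :: "'a measure \<Rightarrow> (nat \<Rightarrow> 'a measure) \<Rightarrow> nat \<Rightarrow> bool" where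
  "filtered_prob_space M F T \<longleftrightarrow> prob_space M \<and>
     (\<forall>t\<le>T. subalgebra M (F t) \<and> null_sets M \<subseteq> sets (F t)) \<and>
     (\<forall>s t. s \<le> t \<and> t \<le> T \<longrightarrow> sets (F s) \<subseteq> sets (F t))"

definition incr :: "(nat \<Rightarrow> 'a \<Rightarrow> 'd::euclidean_space) \<Rightarrow> nat \<Rightarrow> 'a \<Rightarrow> 'd" where
  "incr S t \<omega> = S t \<omega> - S (t - 1) \<omega>"

definition adapted :: "(nat \<Rightarrow> 'a measure) \<Rightarrow> nat \<Rightarrow> (nat \<Rightarrow> 'a \<Rightarrow> 'd::euclidean_space) \<Rightarrow> bool" where
  "adapted F T S \<longleftrightarrow> (\<forall>t\<le>T. S t \<in> borel_measurable (F t))"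

definition strategies :: "(nat \<Rightarrow> 'a measure) \<Rightarrow> nat \<Rightarrow> (nat \<Rightarrow> 'a \<Rightarrow> 'd::euclidean_space) set" where
  "strategies F T = {\<phi>. \<forall>t\<in>{1..T}. \<phi> t \<in> borel_measurable (F (t - 1))}"

definition wealth :: "(nat \<Rightarrow> 'a \<Rightarrow> 'd::euclidean_space) \<Rightarrow> real \<Rightarrow> (nat \<Rightarrow> 'a \<Rightarrow> 'd) \<Rightarrow> nat \<Rightarrow> 'a \<Rightarrow> real" where
  "wealth S w \<phi> t \<omega> = w + (\<Sum>s\<in>{1..t}. \<phi> s \<omega> \<bullet> incr S s \<omega>)"

definition NA :: "'a measure \<Rightarrow> (nat \<Rightarrow> 'a measure) \<Rightarrow> nat \<Rightarrow> (nat \<Rightarrow> 'a \<Rightarrow> 'd::euclidean_space) \<Rightarrow> bool" where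
  "NA M F T S \<longleftrightarrow> (\<forall>\<phi>\<in>strategies F T.
      (AE \<omega> in M. wealth S 0 \<phi> T \<omega> \<ge> 0) \<longrightarrow> (AE \<omega> in M. wealth S 0 \<phi> T \<omega> = 0))"

definition reg_cond_distr :: "'a measure \<Rightarrow> 'a measure \<Rightarrow> ('a \<Rightarrow> 'd::euclidean_space) \<Rightarrow> ('a \<Rightarrow> 'd measure) \<Rightarrow> bool" where
  "reg_cond_distr M G X \<kappa> \<longleftrightarrow>
     (\<forall>\<omega>\<in>space M. prob_space (\<kappa> \<omega>) \<and> sets (\<kappa> \<omega>) = sets borel) \<and>
     (\<forall>B\<in>sets borel. (\<lambda>\<omega>. measure (\<kappa> \<omega>) B) \<in> borel_measurable G) \<and>
     (\<forall>A\<in>sets G. \<forall>B\<in>sets borel.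
        (\<integral>\<omega>. indicator A \<omega> * measure (\<kappa> \<omega>) B \<partial>M) = measure M (A \<inter> X -` B \<inter> space M))"

definition support :: "'d::euclidean_space measure \<Rightarrow> 'd set" where
  "support \<mu> = {x. \<forall>e>0. emeasure \<mu> (ball x e) > 0}"

definition rcd_incr :: "'a measure \<Rightarrow> (nat \<Rightarrow> 'a measure) \<Rightarrow> (nat \<Rightarrow> 'a \<Rightarrow> 'd::euclidean_space) \<Rightarrow> nat \<Rightarrow> 'a \<Rightarrow> 'd measure" where
  "rcd_incr M F S t = (SOME \<kappa>. reg_cond_distr M (F (t - 1)) (incr S t) \<kappa>)"

definition Dset :: "'a measure \<Rightarrow> (nat \<Rightarrow> 'a measure) \<Rightarrow> (nat \<Rightarrow> 'a \<Rightarrow> 'd::euclidean_space) \<Rightarrow> nat \<Rightarrow> 'a \<Rightarrow> 'd set" where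
  "Dset M F S t \<omega> = affine hull (support (rcd_incr M F S t \<omega>))"

definition Sstar :: "'a measure \<Rightarrow> (nat \<Rightarrow> 'a measure) \<Rightarrow> nat \<Rightarrow> (nat \<Rightarrow> 'a \<Rightarrow> 'd::euclidean_space) set \<Rightarrow> (nat \<Rightarrow> 'a \<Rightarrow> 'd) set" where
  "Sstar M F T SS = {S'\<in>SS. NA M F T S' \<and>
      (\<forall>S\<in>SS. \<forall>t\<in>{1..T}. AE \<omega> in M. Dset M F S t \<omega> \<subseteq> Dset M F S' t \<omega>)}"

definition Xi :: "'a measure \<Rightarrow> (nat \<Rightarrow> 'a measure) \<Rightarrow> (nat \<Rightarrow> 'a \<Rightarrow> 'd::euclidean_space) \<Rightarrow> nat \<Rightarrow> ('a \<Rightarrow> 'd) set" where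
  "Xi M F S t = {\<xi>. \<xi> \<in> borel_measurable (F (t - 1)) \<and> (AE \<omega> in M. \<xi> \<omega> \<in> Dset M F S t \<omega>)}"

definition ess_inf_fam :: "'a measure \<Rightarrow> ('i \<Rightarrow> 'a \<Rightarrow> ereal) \<Rightarrow> 'i set \<Rightarrow> 'a \<Rightarrow> ereal" where
  "ess_inf_fam M Y I = (SOME Z. Z \<in> borel_measurable M \<and> (\<forall>i\<in>I. AE \<omega> in M. Z \<omega> \<le> Y i \<omega>) \<and>
      (\<forall>Z'. Z' \<in> borel_measurable M \<and> (\<forall>i\<in>I. AE \<omega> in M. Z' \<omega> \<le> Y i \<omega>) \<longrightarrow>
            (AE \<omega> in M. Z' \<omega> \<le> Z \<omega>)))"

definition cond_prob :: "'a measure \<Rightarrow> 'a measure \<Rightarrow> 'a set \<Rightarrow> 'a \<Rightarrow> real" where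
  "cond_prob M G A = real_cond_exp M G (indicator A)"

definition Wclass :: "'a measure \<Rightarrow> (nat \<Rightarrow> 'a measure) \<Rightarrow> nat \<Rightarrow> ('a \<Rightarrow> real) set" where
  "Wclass M F T = {X. X \<in> borel_measurable (F T) \<and>
      (\<forall>p::real>0. integrable M (\<lambda>\<omega>. \<bar>X \<omega>\<bar> powr p))}"

definition concave_ext :: "(real \<Rightarrow> ereal) \<Rightarrow> bool" where
  "concave_ext U \<longleftrightarrow> (\<forall>x y l. 0 \<le> l \<and> l \<le> 1 \<longrightarrow>
      ereal l * U x + ereal (1 - l) * U y \<le> U (l * x + (1 - l) * y))"

definition usc :: "(real \<Rightarrow> ereal) \<Rightarrow> bool" where
  "usc U \<longleftrightarrow> (\<forall>c. open {x. U x < c})"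

definition utility_assumption :: "(real \<Rightarrow> ereal) \<Rightarrow> bool" where
  "utility_assumption U \<longleftrightarrow> (\<forall>x. U x \<noteq> \<infinity>) \<and> mono U \<and> concave_ext U \<and> usc U"

definition ext_expectation :: "'a measure \<Rightarrow> ('a \<Rightarrow> ereal) \<Rightarrow> ereal" where
  "ext_expectation M X =
     (let p = (\<integral>\<^sup>+ \<omega>. e2ennreal (X \<omega>) \<partial>M); n = (\<integral>\<^sup>+ \<omega>. e2ennreal (- X \<omega>) \<partial>M) in
      if p = \<infinity> \<and> n = \<infinity> then - \<infinity> else enn2ereal p - enn2ereal n)"

definition admissible :: "'a measure \<Rightarrow> (nat \<Rightarrow> 'a measure) \<Rightarrow> nat \<Rightarrow> (nat \<Rightarrow> 'a \<Rightarrow> 'd::euclidean_space) set \<Rightarrow> real \<Rightarrow> (nat \<Rightarrow> 'a \<Rightarrow> 'd) set" where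
  "admissible M F T SS w0 = {\<phi>\<in>strategies F T. \<forall>S\<in>SS. \<forall>t\<le>T. AE \<omega> in M. wealth S w0 \<phi> t \<omega> \<ge> 0}"

definition robust_value :: "'a measure \<Rightarrow> (nat \<Rightarrow> 'a \<Rightarrow> 'd::euclidean_space) set \<Rightarrow> nat \<Rightarrow> (real \<Rightarrow> ereal) \<Rightarrow> real \<Rightarrow> (nat \<Rightarrow> 'a \<Rightarrow> 'd) \<Rightarrow> ereal" where
  "robust_value M SS T U w0 \<phi> = (INF S\<in>SS. ext_expectation M (\<lambda>\<omega>. U (wealth S w0 \<phi> T \<omega>)))"

definition value_fun :: "'a measure \<Rightarrow> (nat \<Rightarrow> 'a measure) \<Rightarrow> nat \<Rightarrow> (nat \<Rightarrow> 'a \<Rightarrow> 'd::euclidean_space) set \<Rightarrow> (real \<Rightarrow> ereal) \<Rightarrow> real \<Rightarrow> ereal" where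
  "value_fun M F T SS U w0 = (SUP \<phi>\<in>admissible M F T SS w0. robust_value M SS T U w0 \<phi>)"

end

theory Submission
  imports Defs
begin

text \<open>
  Under no arbitrage the affine hull \<open>D\<^sub>t\<close> of the conditional support of the increments of \<open>S\<^sup>*\<close> is a linear
  space, and it contains the increments of every model. Hence a strategy can be replaced by its
  pointwise orthogonal projection onto \<open>D\<^sub>t\<close> without changing any wealth process. For projected strategies
  the conditional probability bound and the positivity of the wealth under \<open>S\<^sup>*\<close> give
  \<open>\<parallel>\<phi>\<^sub>t\<parallel> \<le> W\<^sub>t\<^sub>-\<^sub>1 / \<beta>\<^sub>t\<close>, so positions and wealth are dominated by fixed random variables having all moments, and
  the linear growth of \<open>U\<close> bounds the expected utilities from above.

  The projected strategies whose robust value is at least \<open>c\<^sub>n\<close>, with \<open>c\<^sub>n\<close> increasing to the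
  optimal value, form a decreasing sequence of convex sets bounded in \<open>L\<^sup>2\<close>. By the parallelogram law, almost
  norm-minimal elements of these sets converge almost surely, and upper semicontinuity of \<open>U\<close>
  together with Fatou's lemma shows that the limit is optimal.
\<close>

section \<open>Regular conditional distributions\<close>

text \<open>\<open>Dset\<close> rests on a Hilbert choice among regular conditional distributions,
  so it carries information only once such kernels are known to exist. The probability space is
  arbitrary; existence comes from the increments taking values in a Euclidean space. The probability
  bound speaks only of directions in \<open>Dset\<close>, and an admissible position has no bound at
  all in directions orthogonal to it; hence projection precedes every estimate. Positivity of wealth
  then does the rest: where \<open>\<beta> t\<close> times the size of the position exceeds the
  current wealth, the wealth at the next date would be negative with positive conditional
  probability. The family of models may be uncountable, so exceptional null sets may depend on the
  model. This does no harm: the bound on positions comes from \<open>S'\<close> alone, while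
  domination, midpoint concavity and Fatou's lemma are applied to one model at a time. The utility
  may be minus infinity and its negative part need not be integrable, so expectations are compared
  through the integral of a dominating variable minus the utility, which is nonnegative.\<close>

lemma quaternary_digit:
  fixes b :: "nat \<Rightarrow> bool"
  defines "y \<equiv> (\<Sum>n. of_bool (b n) / 4 ^ Suc n :: real)"
  shows "odd \<lfloor>4 ^ Suc n * y\<rfloor> \<longleftrightarrow> b n"
proof -
  have geo: "(\<lambda>n. 1 / 4 ^ Suc n :: real) sums (1/3)"
    using sums_mult[OF geometric_sums[of "1/4::real"], of "1/4"] by (simp add: field_simps)
  have sm: "summable (\<lambda>n. of_bool (c n) / 4 ^ Suc n :: real)" for c :: "nat \<Rightarrow> bool"
    by (rule summable_comparison_test'[OF sums_summable[OF geo], of 0]) (auto simp: field_simps)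
  \<comment> \<open>\<open>r\<close> is what remains behind the point after scaling. With digits 0
    and 1 in base four it is at most 1/3, so the floor removes it; in base two it could reach 1 and
    digits would be ambiguous.\<close>
  define r where "r = (\<Sum>k. of_bool (b (k + Suc n)) / 4 ^ Suc k :: real)"
  have r0: "0 \<le> r" unfolding r_def by (intro suminf_nonneg sm) auto
  have r1: "r < 1"
  proof -
    have "r \<le> (\<Sum>k. 1 / 4 ^ Suc k)" unfolding r_def
      by (intro suminf_le sm sums_summable[OF geo]) (auto simp: field_simps)
    also have "\<dots> = 1/3" using geo by (rule sums_unique[symmetric])
    finally show ?thesis by simp
  qed
  \<comment> \<open>The digits in front of position \<open>n\<close> contribute positive powers of
    four, so they do not affect parity.\<close>
  define N where "N = (\<Sum>k<n. of_bool (b k) * 4 ^ (n - k) :: int)"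
  have "y = (\<Sum>k. of_bool (b (k + Suc n)) / 4 ^ Suc (k + Suc n)) + (\<Sum>k<Suc n. of_bool (b k) / 4 ^ Suc k)"
    unfolding y_def using sm by (rule suminf_split_initial_segment)
  also have "(\<Sum>k. of_bool (b (k + Suc n)) / 4 ^ Suc (k + Suc n)) = r / 4 ^ Suc n"
    unfolding r_def by (subst suminf_divide[OF sm, symmetric]) (simp add: power_add field_simps)
  finally have "4 ^ Suc n * y = r + (\<Sum>k<Suc n. 4 ^ Suc n * (of_bool (b k) / 4 ^ Suc k))"
    by (simp add: field_simps sum_distrib_left)
  also have "(\<Sum>k<Suc n. 4 ^ Suc n * (of_bool (b k) / 4 ^ Suc k) :: real)
      = (\<Sum>k<Suc n. of_bool (b k) * 4 ^ (n - k))"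
    by (intro sum.cong refl) (auto simp: power_diff field_simps)
  also have "\<dots> = of_int (N + of_bool (b n))"
    by (simp add: N_def)
  finally have "\<lfloor>4 ^ Suc n * y\<rfloor> = N + of_bool (b n)"
    using r0 r1 by (intro floor_unique) auto
  moreover have "even N" unfolding N_def by (intro dvd_sum) auto
  ultimately show ?thesis by simp
qed

text \<open>A point is determined by the balls of radius \<open>1 / Suc k\<close> around a dense
  sequence that contain it. These countably many bits, indexed through \<open>prod_decode\<close>,
  become the base-four digits of its code. The coding reduces kernels on a Euclidean space to
  kernels on the unit interval.\<close>

lemma borel_coding_into_real:
  obtains f :: "'d::euclidean_space \<Rightarrow> real" and g :: "real \<Rightarrow> 'd"
  where "f \<in> borel_measurable borel" "g \<in> borel_measurable borel"
    "\<And>x. g (f x) = x" "\<And>x. 0 \<le> f x" "\<And>x. f x < 1"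
proof -
  obtain D :: "'d set" where D: "countable D" "\<And>X. open X \<Longrightarrow> X \<noteq> {} \<Longrightarrow> \<exists>d\<in>D. d \<in> X"
    using countable_dense_setE by metis
  have "D \<noteq> {}" using D(2)[of UNIV] by auto
  define c where "c = from_nat_into D"
  have c: "\<exists>m. dist (c m) x < e" if e: "e > 0" for x e
  proof -
    obtain d where "d \<in> D" "d \<in> ball x e" using D(2)[of "ball x e"] e
      by (metis centre_in_ball empty_iff open_ball)
    then show ?thesis using from_nat_into_surj[OF D(1)] unfolding c_def
      by (metis dist_commute mem_ball)
  qed
  define b where "b = (\<lambda>x n. dist (c (fst (prod_decode n))) x < 1 / Suc (snd (prod_decode n)))"
  define f where "f = (\<lambda>x. \<Sum>n. of_bool (b x n) / 4 ^ Suc n :: real)"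
  \<comment> \<open>Decoding reads off, for each \<open>k\<close>, the first dense point within
    \<open>1 / Suc k\<close> and passes to the limit. At reals that are not codes
    \<open>LEAST\<close> and \<open>lim\<close> return arbitrary values, which does not disturb
    measurability.\<close>
  define g where "g = (\<lambda>y::real. lim (\<lambda>k. c (LEAST m. odd \<lfloor>4 ^ Suc (prod_encode (m,k)) * y\<rfloor>)))"
  have geo: "(\<lambda>n. 1 / 4 ^ Suc n :: real) sums (1/3)"
    using sums_mult[OF geometric_sums[of "1/4::real"], of "1/4"] by (simp add: field_simps)
  have sm: "summable (\<lambda>n. of_bool (b x n) / 4 ^ Suc n :: real)" for x
    by (rule summable_comparison_test'[OF sums_summable[OF geo], of 0]) (auto simp: field_simps)
  have [measurable]: "(\<lambda>x. b x n) \<in> measurable borel (count_space UNIV)" for n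
    unfolding b_def by measurable
  have "f \<in> borel_measurable borel" unfolding f_def of_bool_def by measurable
  moreover have "g \<in> borel_measurable borel" unfolding g_def
  proof (rule borel_measurable_lim_metric)
    fix k
    have "(\<lambda>y::real. LEAST m. odd \<lfloor>4 ^ Suc (prod_encode (m,k)) * y\<rfloor>) \<in> measurable borel (count_space UNIV)"
      by measurable
    then show "(\<lambda>y::real. c (LEAST m. odd \<lfloor>4 ^ Suc (prod_encode (m,k)) * y\<rfloor>)) \<in> borel_measurable borel"
      by (rule measurable_compose) simp
  qed
  moreover have "g (f x) = x" for x
  proof -
    have P: "odd \<lfloor>4 ^ Suc (prod_encode (m,k)) * f x\<rfloor> \<longleftrightarrow> dist (c m) x < 1 / Suc k" for m k
      unfolding f_def quaternary_digit by (simp add: b_def)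
    have "(\<lambda>k. c (LEAST m. dist (c m) x < 1 / Suc k)) \<longlonglongrightarrow> x"
    proof (rule metric_LIMSEQ_I)
      fix e :: real assume "0 < e"
      then obtain K where K: "1 / Suc K < e" using nat_approx_posE by blast
      show "\<exists>no. \<forall>k\<ge>no. dist (c (LEAST m. dist (c m) x < 1 / Suc k)) x < e"
      proof (intro exI allI impI)
        fix k assume "K \<le> k"
        then have "1 / Suc k \<le> 1 / Suc K" by (simp add: frac_le)
        moreover have "dist (c (LEAST m. dist (c m) x < 1 / Suc k)) x < 1 / Suc k"
          by (rule LeastI_ex) (rule c, simp)
        ultimately show "dist (c (LEAST m. dist (c m) x < 1 / Suc k)) x < e" using K by linarith
      qed
    qed
    then show ?thesis unfolding g_def P by (rule limI)
  qed
  moreover have "0 \<le> f x" for x unfolding f_def by (intro suminf_nonneg sm) auto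
  moreover have "f x < 1" for x
  proof -
    have "f x \<le> (\<Sum>k. 1 / 4 ^ Suc k)" unfolding f_def
      by (intro suminf_le sm sums_summable[OF geo]) (auto simp: field_simps)
    also have "\<dots> = 1/3" using geo by (rule sums_unique[symmetric])
    finally show ?thesis by simp
  qed
  ultimately show ?thesis using that by blast
qed

text \<open>Monotone values on the rationals need not be right-continuous; the infimum over strictly
  larger rationals is their right-continuous regularisation. The third claim recovers it as a limit
  of the given values, which later transports integral identities from rational to real
  thresholds.\<close>

lemma cdf_of_rat_mono:
  fixes c :: "rat \<Rightarrow> real"
  assumes mono: "\<And>q r. q \<le> r \<Longrightarrow> c q \<le> c r" and c0: "\<And>q. q < 0 \<Longrightarrow> c q = 0" and c1: "\<And>q. q \<ge> 1 \<Longrightarrow> c q = 1"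
  defines "H \<equiv> \<lambda>y. INF q\<in>{q. y < of_rat q}. c q"
  shows "real_distribution (interval_measure H)"
    and "measure (interval_measure H) {..y} = H y"
    and "(\<And>n. y < of_rat (q n)) \<Longrightarrow> (\<lambda>n. of_rat (q n)) \<longlonglongrightarrow> y \<Longrightarrow> (\<lambda>n. c (q n)) \<longlonglongrightarrow> H y"
proof -
  have nn: "0 \<le> c q" for q
    using mono[of "min q (-1)" q] c0[of "min q (-1)"] by simp
  have bdd: "bdd_below (c ` X)" for X using nn by (intro bdd_belowI[of _ 0]) auto
  have ne: "{q. y < of_rat q} \<noteq> {}" for y :: real
    using of_rat_dense[of y "y + 1"] by auto
  have le: "H y \<le> c q" if "y < of_rat q" for y q
    unfolding H_def using that by (intro cINF_lower bdd) auto
  have ex: "\<exists>q. y < of_rat q \<and> c q < H y + e" if "e > 0" for y e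
    using cINF_less_iff[OF ne[of y] bdd, of "H y + e"] that unfolding H_def by auto
  have Hmono: "H y \<le> H z" if "y \<le> z" for y z
    unfolding H_def by (rule cINF_superset_mono[OF ne bdd]) (use that in auto)
  have H0: "H y = 0" if y: "y < 0" for y
  proof -
    obtain q where "y < of_rat q" "of_rat q < (0::real)" using of_rat_dense[of y 0] y by auto
    then have "H y \<le> 0" using le[of y q] c0[of q] by simp
    moreover have "0 \<le> H y" unfolding H_def by (rule cINF_greatest[OF ne]) (rule nn)
    ultimately show ?thesis by simp
  qed
  have H1: "H y = 1" if "1 \<le> y" for y
  proof -
    have *: "c q = 1" if "y < of_rat q" for q
    proof (rule c1)
      have "1 < (of_rat q :: real)" using \<open>1 \<le> y\<close> that by (rule order.strict_trans1)
      then show "1 \<le> q" by simp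
    qed
    have "H y = (INF q\<in>{q. y < of_rat q}. 1)" unfolding H_def by (intro INF_cong refl) (use * in auto)
    then show ?thesis using ne[of y] by simp
  qed
  have rc: "continuous (at_right a) H" for a
    unfolding continuous_within
  proof (rule tendstoI)
    fix e :: real assume "0 < e"
    then obtain q where q: "a < of_rat q" "c q < H a + e" using ex by blast
    have "\<forall>\<^sub>F x in at_right a. x \<in> {a<..<of_rat q}" using q(1)
      by (intro eventually_at_rightI) auto
    then show "\<forall>\<^sub>F x in at_right a. dist (H x) (H a) < e"
    proof eventually_elim
      case (elim x)
      then have "H a \<le> H x" "H x \<le> c q" using Hmono[of a x] le[of x q] by auto
      then show ?case using q(2) by (simp add: dist_real_def)
    qed
  qed
  have l0: "(H \<longlongrightarrow> 0) at_bot"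
    by (rule tendsto_eventually, rule eventually_mono[OF eventually_gt_at_bot[of 0]]) (rule H0)
  have l1: "(H \<longlongrightarrow> 1) at_top"
    by (rule tendsto_eventually, rule eventually_mono[OF eventually_ge_at_top[of 1]]) (rule H1)
  show "real_distribution (interval_measure H)"
    by (rule real_distribution_interval_measure) (use Hmono rc l0 l1 in auto)
  show "measure (interval_measure H) {..y} = H y"
    by (rule measure_interval_measure_Iic) (use Hmono rc l0 in auto)
  show "(\<lambda>n. c (q n)) \<longlonglongrightarrow> H y"
    if q: "\<And>n. y < of_rat (q n)" "(\<lambda>n. of_rat (q n)) \<longlonglongrightarrow> y"
  proof (rule tendstoI)
    fix e :: real assume "0 < e"
    then obtain r where r: "y < of_rat r" "c r < H y + e" using ex by blast
    have "\<forall>\<^sub>F n in sequentially. of_rat (q n) < (of_rat r :: real)"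
      using order_tendstoD(2)[OF q(2) r(1)] .
    then show "\<forall>\<^sub>F n in sequentially. dist (c (q n)) (H y) < e"
    proof eventually_elim
      case (elim n)
      then have "H y \<le> c (q n)" "c (q n) \<le> c r" using le q(1)[of n] mono[of "q n" r] by (auto simp: of_rat_less)
      then show ?case using r(2) by (simp add: dist_real_def)
    qed
  qed
qed

text \<open>Conditional probabilities of \<open>Y \<le> q\<close> for rational \<open>q\<close> obey
  the rules of a distribution function outside one null set, as only countably many rules are
  involved. The range \<open>[0,1)\<close> fixes the values for \<open>q < 0\<close> and
  \<open>q \<ge> 1\<close>, so the limits at both infinities are immediate.\<close>

lemma reg_cond_distr_real_exists:
  fixes Y :: "'a \<Rightarrow> real"
  assumes M: "prob_space M" and sub: "subalgebra M G" and Y[measurable]: "Y \<in> borel_measurable M"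
    and Y0: "\<And>\<omega>. 0 \<le> Y \<omega>" and Y1: "\<And>\<omega>. Y \<omega> < 1"
  shows "\<exists>\<kappa>. reg_cond_distr M G Y \<kappa>"
proof -
  interpret prob_space M by fact
  interpret finite_measure_subalgebra M G by standard (rule sub)
  have spG: "space G = space M" and setsG: "\<And>A. A \<in> sets G \<Longrightarrow> A \<in> sets M"
    using sub by (auto simp: subalgebra_def)
  define I where "I q = (indicator {\<omega>\<in>space M. Y \<omega> \<le> of_rat q} :: 'a \<Rightarrow> real)" for q :: rat
  have [measurable]: "I q \<in> borel_measurable M" for q unfolding I_def by measurable
  have Iint: "integrable M (I q)" for q
    by (rule integrable_const_bound[of _ 1]) (auto simp: I_def)
  define c where "c q = real_cond_exp M G (I q)" for q
  have [measurable]: "c q \<in> borel_measurable G" for q unfolding c_def by simp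
  have [measurable]: "c q \<in> borel_measurable M" for q unfolding c_def by simp
  define good where "good \<omega> \<longleftrightarrow> (\<forall>q r. q \<le> r \<longrightarrow> c q \<omega> \<le> c r \<omega>) \<and> (\<forall>q<0. c q \<omega> = 0) \<and> (\<forall>q\<ge>1. c q \<omega> = 1)" for \<omega>
  have good_meas[measurable]: "Measurable.pred G good" unfolding good_def by measurable
  have "AE \<omega> in M. \<forall>q r. q \<le> r \<longrightarrow> c q \<omega> \<le> c r \<omega>"
    unfolding AE_all_countable c_def
  proof (intro allI AE_impI real_cond_exp_mono Iint AE_I2)
    fix q r :: rat and \<omega> assume "q \<le> r"
    then have "(of_rat q :: real) \<le> of_rat r" by (simp add: of_rat_less_eq)
    then show "I q \<omega> \<le> I r \<omega>" by (auto simp: I_def split: split_indicator)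
  qed
  moreover have "AE \<omega> in M. \<forall>q<0. c q \<omega> = 0"
    unfolding AE_all_countable
  proof (intro allI AE_impI)
    fix q :: rat assume "q < 0"
    then have "(of_rat q :: real) < 0" by simp
    then have "I q \<omega> = 0" for \<omega> unfolding I_def using order.strict_trans2[OF _ Y0[of \<omega>]]
      by (simp add: indicator_def not_le)
    then have "I q = (\<lambda>\<omega>. 0)" by auto
    then show "AE \<omega> in M. c q \<omega> = 0" unfolding c_def using real_cond_exp_F_meas[of "\<lambda>_. 0"] by simp
  qed
  moreover have "AE \<omega> in M. \<forall>q\<ge>1. c q \<omega> = 1"
    unfolding AE_all_countable
  proof (intro allI AE_impI)
    fix q :: rat assume "q \<ge> 1"
    then have "(of_rat q :: real) \<ge> 1" by (metis of_rat_1 of_rat_less_eq)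
    then have "Y \<omega> \<le> of_rat q" for \<omega> using Y1[of \<omega>] by linarith
    then have "I q \<omega> = 1" if "\<omega> \<in> space M" for \<omega> unfolding I_def using that by simp
    then have "AE \<omega> in M. real_cond_exp M G (I q) \<omega> = real_cond_exp M G (\<lambda>_. 1) \<omega>"
      by (intro real_cond_exp_cong AE_I2) auto
    moreover have "AE \<omega> in M. real_cond_exp M G (\<lambda>_. 1) \<omega> = 1"
      by (rule real_cond_exp_F_meas) auto
    ultimately show "AE \<omega> in M. c q \<omega> = 1" unfolding c_def by eventually_elim simp
  qed
  ultimately have AEgood: "AE \<omega> in M. good \<omega>" unfolding good_def by auto
  \<comment> \<open>On the exceptional set the distribution function of the point mass at 0 is
    substituted, so that every \<open>\<kappa> \<omega>\<close> is a probability. As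
    \<open>good\<close> is an event of \<open>G\<close>, measurability with respect to
    \<open>G\<close> survives.\<close>
  define c' where "c' q \<omega> = (if good \<omega> then c q \<omega> else if q \<ge> 0 then 1 else 0)" for q \<omega>
  have [measurable]: "c' q \<in> borel_measurable G" for q unfolding c'_def by measurable
  have [measurable]: "c' q \<in> borel_measurable M" for q by (rule measurable_from_subalg[OF sub]) measurable
  have c': "\<And>q r. q \<le> r \<Longrightarrow> c' q \<omega> \<le> c' r \<omega>" "\<And>q. q < 0 \<Longrightarrow> c' q \<omega> = 0" "\<And>q. q \<ge> 1 \<Longrightarrow> c' q \<omega> = 1" for \<omega>
    by (auto simp: c'_def good_def)
  have c'01: "0 \<le> c' q \<omega>" "c' q \<omega> \<le> 1" for q \<omega>
    using c'(1)[of "min q (-1)" q \<omega>] c'(2)[of "min q (-1)" \<omega>] c'(1)[of q "max q 1" \<omega>] c'(3)[of "max q 1" \<omega>] by auto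
  define H where "H \<omega> y = (INF q\<in>{q. y < of_rat q}. c' q \<omega>)" for \<omega> and y :: real
  define \<kappa> where "\<kappa> \<omega> = interval_measure (H \<omega>)" for \<omega>
  have H: "H \<omega> = (\<lambda>y. INF q\<in>{q. y < of_rat q}. c' q \<omega>)" for \<omega>
    by (rule ext) (simp add: H_def)
  have cdf: "real_distribution (\<kappa> \<omega>)" "measure (\<kappa> \<omega>) {..y} = H \<omega> y" for \<omega> y
    unfolding \<kappa>_def H using cdf_of_rat_mono(1,2)[of "\<lambda>q. c' q \<omega>", OF c'(1)[of _ _ \<omega>] c'(2)[of _ \<omega>] c'(3)[of _ \<omega>]]
    by auto
  have rd: "real_distribution (\<kappa> \<omega>)" for \<omega> by (rule cdf(1))
  have ps: "prob_space (\<kappa> \<omega>)" and sets_\<kappa>: "sets (\<kappa> \<omega>) = sets borel" and space_\<kappa>: "space (\<kappa> \<omega>) = UNIV" for \<omega>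
    using rd[of \<omega>] sets_eq_imp_space_eq[of "\<kappa> \<omega>" borel]
    by (auto simp: real_distribution_def real_distribution_axioms_def)
  have int: "(\<integral>\<omega>. indicator A \<omega> * c' q \<omega> \<partial>M) = measure M (A \<inter> Y -` {..of_rat q} \<inter> space M)" if A: "A \<in> sets G" for A q
  proof -
    have [measurable]: "A \<in> sets M" using A setsG by auto
    have "(\<integral>\<omega>. indicator A \<omega> * c' q \<omega> \<partial>M) = (\<integral>\<omega>. indicator A \<omega> * c q \<omega> \<partial>M)"
    proof (rule integral_cong_AE)
      show "AE \<omega> in M. indicator A \<omega> * c' q \<omega> = indicator A \<omega> * c q \<omega>"
        using AEgood by eventually_elim (simp add: c'_def)
    qed measurable
    also have "\<dots> = (\<integral>\<omega>\<in>A. I q \<omega> \<partial>M)"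
      using real_cond_exp_intA[OF Iint A, of q] by (simp add: c_def set_lebesgue_integral_def)
    also have "\<dots> = (\<integral>\<omega>. indicator (A \<inter> Y -` {..of_rat q} \<inter> space M) \<omega> \<partial>M)"
      unfolding set_lebesgue_integral_def by (rule Bochner_Integration.integral_cong) (auto simp: I_def split: split_indicator)
    also have "\<dots> = measure M (A \<inter> Y -` {..of_rat q} \<inter> space M)"
      by simp
    finally show ?thesis .
  qed
  \<comment> \<open>Measurability and the integral identity are carried through the induction
    together, since complements and countable unions need the integrands of the previous stage to be
    measurable.\<close>
  define P where "P B \<longleftrightarrow> (\<lambda>\<omega>. measure (\<kappa> \<omega>) B) \<in> borel_measurable G \<and>
     (\<forall>A\<in>sets G. (\<integral>\<omega>. indicator A \<omega> * measure (\<kappa> \<omega>) B \<partial>M) = measure M (A \<inter> Y -` B \<inter> space M))" for B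
  have P_meas: "(\<lambda>\<omega>. measure (\<kappa> \<omega>) B) \<in> borel_measurable M" if "P B" for B
    using that measurable_from_subalg[OF sub] unfolding P_def by blast
  have ind_le: "norm (indicator A \<omega> * measure (\<kappa> \<omega>) B) \<le> 1" for A B \<omega>
    using prob_space.prob_le_1[OF ps] by (auto split: split_indicator)
  have Pint: "integrable M (\<lambda>\<omega>. indicator A \<omega> * measure (\<kappa> \<omega>) B)" if "P B" "A \<in> sets G" for A B
    using P_meas[OF that(1)] setsG[OF that(2)] by (intro integrable_const_bound[of _ 1] AE_I2 ind_le) auto
  have Pm: "(\<integral>\<omega>. indicator A \<omega> * measure (\<kappa> \<omega>) B \<partial>M) = measure M (A \<inter> Y -` B \<inter> space M)"
    if "P B" "A \<in> sets G" for A B using that unfolding P_def by blast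
  \<comment> \<open>Rationals strictly decreasing to \<open>y\<close> in the limit sense,
    \<open>q n > y\<close>, let both sides of the identity for \<open>c'\<close> converge by
    domination; the events \<open>Y \<le> q n\<close> tend to \<open>Y \<le> y\<close> because the
    approach is from the right.\<close>
  have P_atMost: "P {..y}" for y
  proof -
    have "\<exists>q::rat. y < of_rat q \<and> of_rat q < y + 1 / Suc n" for n
      using of_rat_dense[of y "y + 1 / Suc n"] by auto
    then obtain q :: "nat \<Rightarrow> rat" where q: "\<And>n. y < of_rat (q n)" "\<And>n. of_rat (q n) < y + 1 / Suc n" by metis
    have ql: "(\<lambda>n. of_rat (q n)) \<longlonglongrightarrow> y"
    proof (rule tendsto_sandwich)
      show "(\<lambda>n. y) \<longlonglongrightarrow> y" by simp
      show "(\<lambda>n. y + 1 / Suc n) \<longlonglongrightarrow> y"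
        using tendsto_add[OF tendsto_const LIMSEQ_inverse_real_of_nat, of y] by (simp add: inverse_eq_divide)
    qed (use q in \<open>auto intro!: always_eventually less_imp_le\<close>)
    have lim: "(\<lambda>n. c' (q n) \<omega>) \<longlonglongrightarrow> measure (\<kappa> \<omega>) {..y}" for \<omega>
      unfolding cdf(2) H using c' q(1) ql by (intro cdf_of_rat_mono(3)) auto
    have m: "(\<lambda>\<omega>. measure (\<kappa> \<omega>) {..y}) \<in> borel_measurable G"
      by (rule borel_measurable_LIMSEQ_real[OF lim]) measurable
    have mM: "(\<lambda>\<omega>. measure (\<kappa> \<omega>) {..y}) \<in> borel_measurable M" using measurable_from_subalg[OF sub m] .
    have "(\<integral>\<omega>. indicator A \<omega> * measure (\<kappa> \<omega>) {..y} \<partial>M) = measure M (A \<inter> Y -` {..y} \<inter> space M)" if A: "A \<in> sets G" for A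
    proof -
      have AM[measurable]: "A \<in> sets M" using A setsG by auto
      have "(\<lambda>n. \<integral>\<omega>. indicator A \<omega> * c' (q n) \<omega> \<partial>M) \<longlonglongrightarrow> (\<integral>\<omega>. indicator A \<omega> * measure (\<kappa> \<omega>) {..y} \<partial>M)"
        by (rule integral_dominated_convergence[of _ _ _ "\<lambda>_. 1"])
           (use lim mM c'01 in \<open>auto intro!: AE_I2 tendsto_mult_left split: split_indicator\<close>)
      moreover have "(\<lambda>n. \<integral>\<omega>. indicator (A \<inter> Y -` {..of_rat (q n)} \<inter> space M) \<omega> \<partial>M) \<longlonglongrightarrow> (\<integral>\<omega>. indicator (A \<inter> Y -` {..y} \<inter> space M) \<omega> \<partial>M :: real)"
      proof (rule integral_dominated_convergence[of _ _ _ "\<lambda>_. 1"])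
        show "AE \<omega> in M. (\<lambda>n. indicator (A \<inter> Y -` {..of_rat (q n)} \<inter> space M) \<omega> :: real) \<longlonglongrightarrow> indicator (A \<inter> Y -` {..y} \<inter> space M) \<omega>"
        proof (rule AE_I2, rule tendsto_eventually)
          fix \<omega>
          show "\<forall>\<^sub>F n in sequentially. (indicator (A \<inter> Y -` {..of_rat (q n)} \<inter> space M) \<omega> :: real) = indicator (A \<inter> Y -` {..y} \<inter> space M) \<omega>"
          proof (cases "Y \<omega> \<le> y")
            case True
            then have "Y \<omega> \<le> of_rat (q n)" for n using q(1)[of n] by linarith
            then show ?thesis using True by (intro always_eventually allI) (auto split: split_indicator)
          next
            case False
            then have "\<forall>\<^sub>F n in sequentially. of_rat (q n) < Y \<omega>" using order_tendstoD(2)[OF ql, of "Y \<omega>"] by auto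
            then show ?thesis by eventually_elim (use False in \<open>auto split: split_indicator\<close>)
          qed
        qed
      qed (auto split: split_indicator)
      ultimately show ?thesis using int[OF A] LIMSEQ_unique by force
    qed
    then show ?thesis using m by (simp add: P_def)
  qed
  \<comment> \<open>Half-lines are closed under intersection and generate the Borel sets, so the
    disjoint form of Dynkin's induction applies.\<close>
  have all: "P B" if "B \<in> sets borel" for B
  proof -
    have eq: "sets (borel::real measure) = sigma_sets UNIV (range (\<lambda>y. {..y}))"
      by (subst borel_eq_atMost) auto
    have ist: "Int_stable (range (\<lambda>y::real. {..y}))"
      by (auto simp: Int_stable_def)
    have Bin: "B \<in> sigma_sets UNIV (range (\<lambda>y. {..y}))" using that eq by simp
    have psub: "range (\<lambda>y::real. {..y}) \<subseteq> Pow UNIV" by simp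
    from ist psub Bin show ?thesis
    proof (induction rule: sigma_sets_induct_disjoint)
      case (basic X) then show ?case using P_atMost by auto
    next
      case empty
      then show ?case by (simp add: P_def)
    next
      case (compl X)
      then have X: "X \<in> sets borel" using eq by simp
      have e: "measure (\<kappa> \<omega>) (UNIV - X) = 1 - measure (\<kappa> \<omega>) X" for \<omega>
        using prob_space.prob_compl[OF ps, of X \<omega>] X by (simp add: space_\<kappa> sets_\<kappa>)
      have "(\<integral>\<omega>. indicator A \<omega> * (1 - measure (\<kappa> \<omega>) X) \<partial>M) = measure M (A \<inter> Y -` (UNIV - X) \<inter> space M)" if A: "A \<in> sets G" for A
      proof -
        have AM[measurable]: "A \<in> sets M" using A setsG by auto
        have "(\<integral>\<omega>. indicator A \<omega> * (1 - measure (\<kappa> \<omega>) X) \<partial>M) = (\<integral>\<omega>. indicator A \<omega> - indicator A \<omega> * measure (\<kappa> \<omega>) X \<partial>M)"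
          by (simp add: algebra_simps)
        also have "\<dots> = measure M A - measure M (A \<inter> Y -` X \<inter> space M)"
          unfolding Pm[OF compl.IH A, symmetric]
          by (subst Bochner_Integration.integral_diff[OF _ Pint[OF compl.IH A]])
             (auto simp: integrable_indicator_iff less_top[symmetric])
        also have "\<dots> = measure M (A - (A \<inter> Y -` X \<inter> space M))"
          by (rule finite_measure_Diff[symmetric]) (use X Y in \<open>auto intro!: sets.Int simp: Int_assoc measurable_sets\<close>)
        also have "A - (A \<inter> Y -` X \<inter> space M) = A \<inter> Y -` (UNIV - X) \<inter> space M"
          using sets.sets_into_space[OF AM] by auto
        finally show ?thesis .
      qed
      moreover have "(\<lambda>\<omega>. 1 - measure (\<kappa> \<omega>) X) \<in> borel_measurable G"
        using compl.IH unfolding P_def by (intro borel_measurable_diff borel_measurable_const) blast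
      ultimately show ?case unfolding P_def e by blast
    next
      case (union N)
      then have N: "N i \<in> sets borel" for i using eq by auto
      have dj: "disjoint_family N" using union by auto
      have sums: "(\<lambda>i. measure (\<kappa> \<omega>) (N i)) sums measure (\<kappa> \<omega>) (\<Union>i. N i)" for \<omega>
        by (rule finite_measure.finite_measure_UNION[OF prob_space.finite_measure[OF ps]]) (use dj N sets_\<kappa> in auto)
      have m: "(\<lambda>\<omega>. measure (\<kappa> \<omega>) (\<Union>i. N i)) \<in> borel_measurable G"
        unfolding sums_unique[OF sums] using union.IH unfolding P_def
        by (intro borel_measurable_suminf) blast
      have mM: "(\<lambda>\<omega>. measure (\<kappa> \<omega>) (\<Union>i. N i)) \<in> borel_measurable M" using measurable_from_subalg[OF sub m] .
      have "(\<integral>\<omega>. indicator A \<omega> * measure (\<kappa> \<omega>) (\<Union>i. N i) \<partial>M) = measure M (A \<inter> Y -` (\<Union>i. N i) \<inter> space M)" if A: "A \<in> sets G" for A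
      proof -
        have AM[measurable]: "A \<in> sets M" using A setsG by auto
        have "(\<lambda>n. \<integral>\<omega>. (\<Sum>i<n. indicator A \<omega> * measure (\<kappa> \<omega>) (N i)) \<partial>M) \<longlonglongrightarrow> (\<integral>\<omega>. indicator A \<omega> * measure (\<kappa> \<omega>) (\<Union>i. N i) \<partial>M)"
        proof (rule integral_dominated_convergence[of _ _ _ "\<lambda>_. 1"])
          show "AE \<omega> in M. (\<lambda>n. \<Sum>i<n. indicator A \<omega> * measure (\<kappa> \<omega>) (N i)) \<longlonglongrightarrow> indicator A \<omega> * measure (\<kappa> \<omega>) (\<Union>i. N i)"
            using sums_mult[OF sums] unfolding sums_def by (intro AE_I2) blast
          fix n
          show "AE \<omega> in M. norm (\<Sum>i<n. indicator A \<omega> * measure (\<kappa> \<omega>) (N i)) \<le> 1"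
          proof (rule AE_I2)
            fix \<omega>
            have "(\<Sum>i<n. measure (\<kappa> \<omega>) (N i)) \<le> measure (\<kappa> \<omega>) (\<Union>i. N i)"
              unfolding sums_unique[OF sums] by (rule sum_le_suminf[OF sums_summable[OF sums]]) auto
            also have "\<dots> \<le> 1" by (rule prob_space.prob_le_1[OF ps])
            finally show "norm (\<Sum>i<n. indicator A \<omega> * measure (\<kappa> \<omega>) (N i)) \<le> 1"
              unfolding sum_distrib_left[symmetric] by (cases "\<omega> \<in> A") (auto simp: sum_nonneg)
          qed
        next
          fix n
          show "(\<lambda>\<omega>. \<Sum>i<n. indicator A \<omega> * measure (\<kappa> \<omega>) (N i)) \<in> borel_measurable M"
            by (intro borel_measurable_sum borel_measurable_times borel_measurable_indicator AM P_meas[OF union.IH])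
        qed (auto intro!: borel_measurable_times mM)
        moreover have "(\<integral>\<omega>. (\<Sum>i<n. indicator A \<omega> * measure (\<kappa> \<omega>) (N i)) \<partial>M) = (\<Sum>i<n. measure M (A \<inter> Y -` N i \<inter> space M))" for n
          by (subst Bochner_Integration.integral_sum[OF Pint[OF union.IH A]]) (simp add: Pm[OF union.IH A])
        moreover have "(\<lambda>i. measure M (A \<inter> Y -` N i \<inter> space M)) sums measure M (\<Union>i. A \<inter> Y -` N i \<inter> space M)"
        proof (rule finite_measure_UNION)
          show "range (\<lambda>i. A \<inter> Y -` N i \<inter> space M) \<subseteq> sets M"
            using AM measurable_sets[OF Y N] by (auto simp: Int_assoc)
          show "disjoint_family (\<lambda>i. A \<inter> Y -` N i \<inter> space M)"
            using dj by (auto simp: disjoint_family_on_def)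
        qed
        moreover have "(\<Union>i. A \<inter> Y -` N i \<inter> space M) = A \<inter> Y -` (\<Union>i. N i) \<inter> space M" by auto
        ultimately show ?thesis unfolding sums_def using LIMSEQ_unique by force
      qed
      then show ?case using m unfolding P_def by blast
    qed
  qed
  show ?thesis
    unfolding reg_cond_distr_def using ps sets_\<kappa> all by (intro exI[of _ \<kappa>]) (auto simp: P_def)
qed

lemma reg_cond_distr_exists:
  fixes X :: "'a \<Rightarrow> 'd::euclidean_space"
  assumes M: "prob_space M" and sub: "subalgebra M G" and X[measurable]: "X \<in> borel_measurable M"
  shows "\<exists>\<kappa>. reg_cond_distr M G X \<kappa>"
proof -
  obtain f :: "'d \<Rightarrow> real" and g where f[measurable]: "f \<in> borel_measurable borel" and g[measurable]: "g \<in> borel_measurable borel"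
    and gf: "\<And>x. g (f x) = x" and f01: "\<And>x. 0 \<le> f x" "\<And>x. f x < 1"
    using borel_coding_into_real by metis
  have "(\<lambda>\<omega>. f (X \<omega>)) \<in> borel_measurable M" by measurable
  then obtain \<kappa> where \<kappa>: "reg_cond_distr M G (\<lambda>\<omega>. f (X \<omega>)) \<kappa>"
    using reg_cond_distr_real_exists[OF M sub, of "\<lambda>\<omega>. f (X \<omega>)"] f01 by auto
  have gk: "g \<in> measurable (\<kappa> \<omega>) borel" if "\<omega> \<in> space M" for \<omega>
    using \<kappa> that g by (auto simp: reg_cond_distr_def cong: measurable_cong_sets)
  have gB: "g -` B \<in> sets borel" if "B \<in> sets borel" for B
    using measurable_sets[OF g that] by simp
  have md: "measure (distr (\<kappa> \<omega>) borel g) B = measure (\<kappa> \<omega>) (g -` B)" if "\<omega> \<in> space M" "B \<in> sets borel" for \<omega> B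
  proof -
    have "sets (\<kappa> \<omega>) = sets borel" using \<kappa> that(1) by (simp add: reg_cond_distr_def)
    then have "space (\<kappa> \<omega>) = UNIV" by (simp add: sets_eq_imp_space_eq)
    then show ?thesis using measure_distr[OF gk that(2)] that by simp
  qed
  have "space G = space M" using sub by (auto simp: subalgebra_def)
  then have "(\<lambda>\<omega>. measure (distr (\<kappa> \<omega>) borel g) B) \<in> borel_measurable G" if "B \<in> sets borel" for B
    using \<kappa> gB[OF that] md[OF _ that] by (subst measurable_cong[where g="\<lambda>\<omega>. measure (\<kappa> \<omega>) (g -` B)"]) (auto simp: reg_cond_distr_def)
  moreover have "(\<integral>\<omega>. indicator A \<omega> * measure (distr (\<kappa> \<omega>) borel g) B \<partial>M) = measure M (A \<inter> X -` B \<inter> space M)"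
    if "A \<in> sets G" "B \<in> sets borel" for A B
  proof -
    have "(\<integral>\<omega>. indicator A \<omega> * measure (distr (\<kappa> \<omega>) borel g) B \<partial>M) = (\<integral>\<omega>. indicator A \<omega> * measure (\<kappa> \<omega>) (g -` B) \<partial>M)"
      by (rule Bochner_Integration.integral_cong) (use md that in auto)
    also have "\<dots> = measure M (A \<inter> (\<lambda>\<omega>. f (X \<omega>)) -` (g -` B) \<inter> space M)"
      using \<kappa> gB that by (auto simp: reg_cond_distr_def)
    also have "(\<lambda>\<omega>. f (X \<omega>)) -` (g -` B) = X -` B" using gf by auto
    finally show ?thesis .
  qed
  moreover have "prob_space (distr (\<kappa> \<omega>) borel g)" if "\<omega> \<in> space M" for \<omega>
    using \<kappa> that gk[OF that] by (auto simp: reg_cond_distr_def intro!: prob_space.prob_space_distr)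
  ultimately show ?thesis
    unfolding reg_cond_distr_def by (intro exI[of _ "\<lambda>\<omega>. distr (\<kappa> \<omega>) borel g"]) auto
qed

section \<open>Measurable projections\<close>

text \<open>By second countability the complement of the support is covered by countably many basis
  sets of measure zero.\<close>

lemma AE_in_support:
  fixes \<mu> :: "'d::euclidean_space measure"
  assumes s: "sets \<mu> = sets borel"
  shows "AE x in \<mu>. x \<in> support \<mu>"
proof -
  obtain B :: "'d set set" where B: "countable B" "topological_basis B" using ex_countable_basis by blast
  have Bs: "b \<in> sets \<mu>" if "b \<in> B" for b
    using topological_basis_open[OF B(2) that] s by auto
  have "AE x in \<mu>. \<forall>b\<in>B. emeasure \<mu> b = 0 \<longrightarrow> x \<notin> b"
  proof (subst AE_ball_countable[OF B(1)], intro ballI AE_impI)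
    fix b assume "b \<in> B" "emeasure \<mu> b = 0"
    then show "AE x in \<mu>. x \<notin> b" using Bs by (intro AE_not_in null_setsI)
  qed
  then show ?thesis
  proof eventually_elim
    case (elim x)
    show ?case unfolding support_def
    proof (intro CollectI allI impI)
      fix e :: real assume "e > 0"
      then obtain b where b: "b \<in> B" "x \<in> b" "b \<subseteq> ball x e"
        using topological_basisE[OF B(2) open_ball, of x x e] by auto
      then have "emeasure \<mu> b > 0" using elim by (auto simp: zero_less_iff_neq_zero)
      also have "emeasure \<mu> b \<le> emeasure \<mu> (ball x e)" using b s by (intro emeasure_mono) auto
      finally show "0 < emeasure \<mu> (ball x e)" .
    qed
  qed
qed

lemma support_subset_closed:
  fixes \<mu> :: "'d::euclidean_space measure"
  assumes s: "sets \<mu> = sets borel" and F: "closed F" and AE: "AE x in \<mu>. x \<in> F"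
  shows "support \<mu> \<subseteq> F"
proof (rule ccontr)
  assume "\<not> ?thesis"
  then obtain x where x: "x \<in> support \<mu>" "x \<notin> F" by auto
  then obtain e where e: "e > 0" "ball x e \<subseteq> - F" using F open_contains_ball[of "- F"] by (auto simp: open_Compl)
  have "AE x' in \<mu>. x' \<notin> ball x e" using AE by eventually_elim (use e in auto)
  then have "emeasure \<mu> (ball x e) = 0" using s by (subst (asm) AE_iff_measurable[of "ball x e"]) (auto simp: sets_eq_imp_space_eq[OF s])
  then show False using x(1) e(1) by (auto simp: support_def)
qed

text \<open>The hypothesis \<open>contr\<close> says that the square of \<open>A\<close> is below
  \<open>A\<close>, so the spectrum lies in \<open>[0,1]\<close> and the powers converge to the
  orthogonal projection onto the fixed space. No diagonalisation is used: squared distances of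
  iterates are combinations of the moments \<open>a k\<close>, which decrease to a limit.\<close>

lemma self_adjoint_power_limit:
  fixes A :: "'e::euclidean_space \<Rightarrow> 'e"
  assumes lin: "linear A" and sym: "\<And>u v. A u \<bullet> v = u \<bullet> A v" and contr: "\<And>v. A v \<bullet> A v \<le> A v \<bullet> v"
  obtains w where "(\<lambda>n. (A ^^ n) v) \<longlonglongrightarrow> w" "A w = w" "\<And>u. A u = u \<Longrightarrow> (v - w) \<bullet> u = 0"
proof -
  define a where "a k = (A ^^ k) v \<bullet> v" for k
  have shift: "(A ^^ n) u \<bullet> u' = u \<bullet> (A ^^ n) u'" for n u u'
    by (induction n arbitrary: u') (auto simp: sym funpow_swap1[symmetric])
  have inner: "(A ^^ n) v \<bullet> (A ^^ m) v = a (n + m)" for n m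
    unfolding a_def using shift[of m "(A ^^ n) v" v] by (simp add: funpow_add add.commute[of n m])
  have le: "A u \<bullet> u \<le> u \<bullet> u" for u
  proof -
    have "norm (A u) * norm (A u) \<le> norm (A u) * norm u"
      using contr[of u] norm_cauchy_schwarz[of "A u" u] by (simp add: dot_square_norm power2_eq_square)
    then have "norm (A u) \<le> norm u" by (cases "norm (A u) = 0") auto
    then have "norm (A u) * norm u \<le> norm u * norm u" by (intro mult_right_mono) auto
    then show ?thesis using norm_cauchy_schwarz[of "A u" u] by (simp add: dot_square_norm power2_eq_square)
  qed
  \<comment> \<open>At even indices the step is the inequality \<open>A \<le> I\<close> applied to
    an iterate, at odd indices it is \<open>contr\<close>.\<close>
  have dec: "a (Suc k) \<le> a k" for k
  proof (cases "even k")
    case True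
    then obtain m where k: "k = m + m" by (metis evenE mult_2)
    show ?thesis using le[of "(A ^^ m) v"] inner[of "Suc m" m] inner[of m m] by (simp add: k)
  next
    case False
    then obtain m where k: "k = Suc (m + m)" by (metis oddE mult_2 Suc_eq_plus1)
    show ?thesis using contr[of "(A ^^ m) v"] inner[of "Suc m" m] inner[of "Suc m" "Suc m"] by (simp add: k)
  qed
  have nn: "a k \<ge> 0" for k
  proof -
    have "a (k + k) \<ge> 0" using inner[of k k] by (metis inner_ge_zero)
    moreover have "a (k + k) \<le> a k" using lift_Suc_antimono_le[of a k "k + k"] dec by simp
    ultimately show ?thesis by simp
  qed
  have "convergent a"
    by (rule Bseq_monoseq_convergent[OF decseq_bounded decseq_imp_monoseq]) (auto intro!: decseq_SucI dec nn)
  then obtain L where L: "a \<longlonglongrightarrow> L" by (auto simp: convergent_def)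
  have "Cauchy (\<lambda>n. (A ^^ n) v)"
  proof (rule metric_CauchyI)
    fix e :: real assume e: "e > 0"
    then have "e\<^sup>2 / 4 > 0" by simp
    from LIMSEQ_D[OF L this] obtain N where N: "\<And>k. k \<ge> N \<Longrightarrow> \<bar>a k - L\<bar> < e\<^sup>2 / 4" by auto
    show "\<exists>N. \<forall>m\<ge>N. \<forall>n\<ge>N. dist ((A ^^ m) v) ((A ^^ n) v) < e"
    proof (intro exI allI impI)
      fix m n assume "m \<ge> N" "n \<ge> N"
      have "(dist ((A ^^ m) v) ((A ^^ n) v))\<^sup>2 = a (m + m) - 2 * a (m + n) + a (n + n)"
        unfolding dist_norm by (simp add: power2_norm_eq_inner inner_diff_left inner_diff_right inner add.commute)
      also have "\<dots> < e\<^sup>2"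
      proof -
        have "\<bar>a (m + m) - L\<bar> < e\<^sup>2 / 4" "\<bar>a (m + n) - L\<bar> < e\<^sup>2 / 4" "\<bar>a (n + n) - L\<bar> < e\<^sup>2 / 4"
          using N \<open>m \<ge> N\<close> \<open>n \<ge> N\<close> by auto
        then show ?thesis by linarith
      qed
      finally show "dist ((A ^^ m) v) ((A ^^ n) v) < e" using e by (simp add: power_less_imp_less_base)
    qed
  qed
  then obtain w where w: "(\<lambda>n. (A ^^ n) v) \<longlonglongrightarrow> w" using Cauchy_convergent convergent_def by blast
  have "(\<lambda>n. A ((A ^^ n) v)) \<longlonglongrightarrow> A w"
    using bounded_linear.tendsto[OF linear_conv_bounded_linear[THEN iffD1, OF lin] w] .
  moreover have "(\<lambda>n. A ((A ^^ n) v)) \<longlonglongrightarrow> w" using LIMSEQ_Suc[OF w] by simp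
  ultimately have "A w = w" by (rule LIMSEQ_unique)
  \<comment> \<open>Self-adjointness moves the powers onto \<open>u\<close>, which they fix; hence
    \<open>u\<close> has the same inner product with all iterates and with their limit.\<close>
  moreover have "(v - w) \<bullet> u = 0" if u: "A u = u" for u
  proof -
    have "(A ^^ n) u = u" for n by (induction n) (auto simp: u)
    then have "(A ^^ n) v \<bullet> u = v \<bullet> u" for n by (simp add: shift)
    then have "(\<lambda>n. v \<bullet> u) \<longlonglongrightarrow> w \<bullet> u" using tendsto_inner[OF w tendsto_const, of u] by simp
    then have "v \<bullet> u = w \<bullet> u" by (simp add: LIMSEQ_const_iff)
    then show ?thesis by (simp add: inner_diff_left)
  qed
  ultimately show ?thesis using w that by blast
qed

text \<open>The projection is the limit of \<open>(I - C)\<^sup>n\<close> for the second moment matrix \<open>C\<close> of a bounded rescaling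
  of \<open>f\<close> under the kernel; this makes its measurability evident.\<close>

lemma kernel_orthogonal_projection:
  fixes \<kappa> :: "'a \<Rightarrow> 'd::euclidean_space measure" and f :: "'d \<Rightarrow> 'e::euclidean_space" and \<phi> :: "'a \<Rightarrow> 'e"
  assumes ps: "\<And>\<omega>. \<omega> \<in> space G \<Longrightarrow> prob_space (\<kappa> \<omega>)" and s: "\<And>\<omega>. \<omega> \<in> space G \<Longrightarrow> sets (\<kappa> \<omega>) = sets borel"
    and m: "\<And>B. B \<in> sets borel \<Longrightarrow> (\<lambda>\<omega>. measure (\<kappa> \<omega>) B) \<in> borel_measurable G"
    and f: "continuous_on UNIV f" and \<phi>: "\<phi> \<in> borel_measurable G"
  obtains h where "h \<in> borel_measurable G"
    "\<And>\<omega> x. \<omega> \<in> space G \<Longrightarrow> x \<in> support (\<kappa> \<omega>) \<Longrightarrow> h \<omega> \<bullet> f x = 0"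
    "\<And>\<omega> u. \<omega> \<in> space G \<Longrightarrow> (\<And>x. x \<in> support (\<kappa> \<omega>) \<Longrightarrow> u \<bullet> f x = 0) \<Longrightarrow> (\<phi> \<omega> - h \<omega>) \<bullet> u = 0"
proof -
  have \<kappa>[measurable]: "\<kappa> \<in> measurable G (subprob_algebra borel)"
  proof (rule measurable_subprob_algebra)
    fix \<omega> assume w: "\<omega> \<in> space G"
    show "subprob_space (\<kappa> \<omega>)" using ps[OF w] by (rule prob_space_imp_subprob_space)
    show "sets (\<kappa> \<omega>) = sets borel" using s[OF w] .
  next
    fix B :: "'d set" assume B: "B \<in> sets borel"
    have "(\<lambda>\<omega>. ennreal (measure (\<kappa> \<omega>) B)) \<in> borel_measurable G" using m[OF B] by simp
    then show "(\<lambda>\<omega>. emeasure (\<kappa> \<omega>) B) \<in> borel_measurable G"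
      by (subst measurable_cong[where g="\<lambda>\<omega>. ennreal (measure (\<kappa> \<omega>) B)"])
         (auto simp: prob_space.finite_measure[OF ps] finite_measure.emeasure_eq_measure)
  qed
  have f_meas[measurable]: "f \<in> borel_measurable borel" using f by (rule borel_measurable_continuous_onI)
  \<comment> \<open>The rescaling makes the second moments exist without integrability assumptions
    and keeps \<open>C\<close> below the identity. Its factor is positive, so orthogonality to
    \<open>f x\<close> is unchanged.\<close>
  define y where "y x = f x /\<^sub>R (1 + norm (f x))" for x
  have y1: "norm (y x) \<le> 1" for x
  proof -
    have "0 < 1 + norm (f x)" using norm_ge_zero[of "f x"] by linarith
    then show ?thesis unfolding y_def by (simp add: divide_simps)
  qed
  have yf: "y x \<bullet> u = 0 \<longleftrightarrow> u \<bullet> f x = 0" for x u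
  proof -
    have "1 + norm (f x) \<noteq> 0" using norm_ge_zero[of "f x"] by linarith
    then show ?thesis by (auto simp: y_def inner_commute)
  qed
  have y_meas[measurable]: "y \<in> borel_measurable borel" unfolding y_def by measurable
  have yu: "\<bar>y x \<bullet> u\<bar> \<le> norm u" for x u
    using Cauchy_Schwarz_ineq2[of "y x" u] mult_right_mono[OF y1[of x] norm_ge_zero[of u]] by linarith
  define c where "c \<omega> j = (\<integral>x. (y x \<bullet> j) *\<^sub>R y x \<partial>\<kappa> \<omega>)" for \<omega> j
  have c_meas: "(\<lambda>\<omega>. c \<omega> j) \<in> borel_measurable G" for j
    unfolding c_def by (rule measurable_compose[OF \<kappa> integral_measurable_subprob_algebra]) measurable
  \<comment> \<open>Expanding \<open>v\<close> in the basis reduces measurability in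
    \<open>\<omega>\<close> to the finitely many integrals \<open>c \<omega> j\<close>.\<close>
  define C where "C \<omega> v = (\<Sum>j\<in>Basis. (v \<bullet> j) *\<^sub>R c \<omega> j)" for \<omega> v
  define A where "A \<omega> v = v - C \<omega> v" for \<omega> v
  have lin: "linear (A \<omega>)" for \<omega>
    unfolding A_def C_def
    by (rule linearI) (auto simp: inner_add_left inner_scaleR_left algebra_simps sum.distrib scaleR_sum_right)
  have intg: "integrable (\<kappa> \<omega>) (\<lambda>x. (y x \<bullet> u) * (y x \<bullet> v))"
    and intg2: "integrable (\<kappa> \<omega>) (\<lambda>x. (y x \<bullet> u) *\<^sub>R y x)" if w: "\<omega> \<in> space G" for \<omega> u v
  proof -
    interpret prob_space "\<kappa> \<omega>" using ps[OF w] .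
    have [measurable]: "y \<in> borel_measurable (\<kappa> \<omega>)"
      using y_meas by (simp add: measurable_cong_sets[OF s[OF w] refl])
    show "integrable (\<kappa> \<omega>) (\<lambda>x. (y x \<bullet> u) * (y x \<bullet> v))"
      by (rule integrable_const_bound[of _ "norm u * norm v"]) (auto simp: abs_mult intro!: mult_mono yu)
    have "norm ((y x \<bullet> u) *\<^sub>R y x) \<le> norm u * 1" for x unfolding norm_scaleR by (intro mult_mono) (auto simp: yu y1)
    then show "integrable (\<kappa> \<omega>) (\<lambda>x. (y x \<bullet> u) *\<^sub>R y x)"
      by (intro integrable_const_bound[of _ "norm u"]) auto
  qed
  have CI: "C \<omega> v \<bullet> u = (\<integral>x. (y x \<bullet> v) * (y x \<bullet> u) \<partial>\<kappa> \<omega>)" if w: "\<omega> \<in> space G" for \<omega> u v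
  proof -
    have "C \<omega> v \<bullet> u = (\<Sum>j\<in>Basis. (v \<bullet> j) * (\<integral>x. (y x \<bullet> j) * (y x \<bullet> u) \<partial>\<kappa> \<omega>))"
      unfolding C_def c_def inner_sum_left
      by (intro sum.cong refl) (simp add: integral_inner_left[symmetric] intg2[OF w] del: integral_inner_left)
    also have "\<dots> = (\<integral>x. (\<Sum>j\<in>Basis. (v \<bullet> j) * ((y x \<bullet> j) * (y x \<bullet> u))) \<partial>\<kappa> \<omega>)"
      by (subst Bochner_Integration.integral_sum) (auto intro!: integrable_mult_right intg w)
    also have "\<dots> = (\<integral>x. (y x \<bullet> v) * (y x \<bullet> u) \<partial>\<kappa> \<omega>)"
      by (intro Bochner_Integration.integral_cong refl, subst euclidean_inner[of _ v]) (simp add: sum_distrib_left mult_ac)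
    finally show ?thesis .
  qed
  have sym: "A \<omega> u \<bullet> v = u \<bullet> A \<omega> v" if "\<omega> \<in> space G" for \<omega> u v
    using CI[OF that, of u v] CI[OF that, of v u]
    by (simp add: A_def inner_diff_left inner_diff_right inner_commute[of u "C \<omega> v"] mult.commute)
  have C_le: "C \<omega> u \<bullet> u \<le> u \<bullet> u" if w: "\<omega> \<in> space G" for \<omega> u
  proof -
    interpret prob_space "\<kappa> \<omega>" using ps[OF w] .
    have "C \<omega> u \<bullet> u \<le> (\<integral>x. u \<bullet> u \<partial>\<kappa> \<omega>)" unfolding CI[OF w]
    proof (rule integral_mono)
      fix x
      have "\<bar>y x \<bullet> u\<bar> * \<bar>y x \<bullet> u\<bar> \<le> norm u * norm u" by (intro mult_mono yu) auto
      then show "(y x \<bullet> u) * (y x \<bullet> u) \<le> u \<bullet> u" by (simp add: dot_square_norm power2_eq_square)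
    qed (auto intro: intg w)
    then show ?thesis by (simp add: prob_space)
  qed
  \<comment> \<open>For \<open>A = I - C\<close> the claim amounts to
    \<open>C v \<bullet> C v \<le> C v \<bullet> v\<close>. It follows by integrating
    \<open>2ab \<le> a^2 + b^2\<close> for the inner products of \<open>y x\<close> with
    \<open>v\<close> and \<open>C v\<close>, and absorbing the last term by
    \<open>C_le\<close>.\<close>
  have contr: "A \<omega> v \<bullet> A \<omega> v \<le> A \<omega> v \<bullet> v" if w: "\<omega> \<in> space G" for \<omega> v
  proof -
    let ?c = "C \<omega> v"
    have "2 * (?c \<bullet> ?c) = (\<integral>x. 2 * ((y x \<bullet> v) * (y x \<bullet> ?c)) \<partial>\<kappa> \<omega>)" by (simp add: CI[OF w, of v ?c])
    also have "\<dots> \<le> (\<integral>x. (y x \<bullet> v) * (y x \<bullet> v) + (y x \<bullet> ?c) * (y x \<bullet> ?c) \<partial>\<kappa> \<omega>)"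
    proof (rule integral_mono)
      fix x
      show "2 * ((y x \<bullet> v) * (y x \<bullet> ?c)) \<le> (y x \<bullet> v) * (y x \<bullet> v) + (y x \<bullet> ?c) * (y x \<bullet> ?c)"
        using sum_squares_bound[of "y x \<bullet> v" "y x \<bullet> ?c"] by (simp add: power2_eq_square mult.assoc)
    qed (auto intro!: intg w Bochner_Integration.integrable_add)
    also have "\<dots> = ?c \<bullet> v + C \<omega> ?c \<bullet> ?c"
      by (subst Bochner_Integration.integral_add) (auto simp: intg w CI)
    finally have "?c \<bullet> ?c \<le> ?c \<bullet> v" using C_le[OF w, of ?c] by linarith
    then show ?thesis by (simp add: A_def inner_diff_left inner_diff_right inner_commute[of v ?c])
  qed
  \<comment> \<open>The fixed space of \<open>A\<close> is the kernel of \<open>C\<close>, and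
    \<open>C u \<bullet> u\<close> is the integral of a square. An almost sure zero extends to the
    whole support because the zero set is closed, \<open>f\<close> being continuous.\<close>
  have fix_iff: "A \<omega> u = u \<longleftrightarrow> (\<forall>x\<in>support (\<kappa> \<omega>). u \<bullet> f x = 0)" if w: "\<omega> \<in> space G" for \<omega> u
  proof
    assume "A \<omega> u = u"
    then have "C \<omega> u \<bullet> u = 0" by (simp add: A_def)
    then have "(\<integral>x. (y x \<bullet> u) * (y x \<bullet> u) \<partial>\<kappa> \<omega>) = 0" using CI[OF w, of u u] by simp
    then have "AE x in \<kappa> \<omega>. (y x \<bullet> u) * (y x \<bullet> u) = 0"
      by (subst (asm) integral_nonneg_eq_0_iff_AE) (auto intro: intg w)
    then have "AE x in \<kappa> \<omega>. x \<in> {x. u \<bullet> f x = 0}" by (simp add: yf)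
    moreover have "closed {x. u \<bullet> f x = 0}"
      by (intro closed_Collect_eq continuous_intros continuous_on_compose2[OF f]) auto
    ultimately show "\<forall>x\<in>support (\<kappa> \<omega>). u \<bullet> f x = 0" using support_subset_closed[OF s[OF w]] by blast
  next
    assume u: "\<forall>x\<in>support (\<kappa> \<omega>). u \<bullet> f x = 0"
    have "C \<omega> u \<bullet> z = 0" for z
      unfolding CI[OF w]
    proof (rule integral_eq_zero_AE)
      show "AE x in \<kappa> \<omega>. (y x \<bullet> u) * (y x \<bullet> z) = 0"
        using AE_in_support[OF s[OF w]] by eventually_elim (use u yf in auto)
    qed
    then have "C \<omega> u = 0" by (metis inner_eq_zero_iff)
    then show "A \<omega> u = u" by (simp add: A_def)
  qed
  define h where "h \<omega> = lim (\<lambda>n. (A \<omega> ^^ n) (\<phi> \<omega>))" for \<omega>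
  have "(\<lambda>\<omega>. (A \<omega> ^^ n) (\<phi> \<omega>)) \<in> borel_measurable G" for n
  proof (induction n)
    case 0 then show ?case using \<phi> by simp
  next
    case (Suc n)
    define g where "g = (\<lambda>\<omega>. (A \<omega> ^^ n) (\<phi> \<omega>))"
    have [measurable]: "g \<in> borel_measurable G" unfolding g_def by (rule Suc)
    note [measurable] = c_meas
    have "(\<lambda>\<omega>. A \<omega> (g \<omega>)) \<in> borel_measurable G" unfolding A_def C_def by measurable
    then show ?case by (simp add: g_def)
  qed
  then have "h \<in> borel_measurable G" unfolding h_def by (rule borel_measurable_lim_metric)
  moreover have "h \<omega> \<bullet> f x = 0" if w: "\<omega> \<in> space G" and x: "x \<in> support (\<kappa> \<omega>)" for \<omega> x
  proof -
    obtain z where "(\<lambda>n. (A \<omega> ^^ n) (\<phi> \<omega>)) \<longlonglongrightarrow> z" "A \<omega> z = z"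
      using self_adjoint_power_limit[OF lin sym[OF w] contr[OF w]] by metis
    then have "A \<omega> (h \<omega>) = h \<omega>" unfolding h_def by (simp add: limI)
    then show ?thesis using fix_iff[OF w] x by auto
  qed
  moreover have "(\<phi> \<omega> - h \<omega>) \<bullet> u = 0" if w: "\<omega> \<in> space G" and u: "\<And>x. x \<in> support (\<kappa> \<omega>) \<Longrightarrow> u \<bullet> f x = 0" for \<omega> u
  proof -
    obtain z where "(\<lambda>n. (A \<omega> ^^ n) (\<phi> \<omega>)) \<longlonglongrightarrow> z" "\<And>u. A \<omega> u = u \<Longrightarrow> (\<phi> \<omega> - z) \<bullet> u = 0"
      using self_adjoint_power_limit[OF lin sym[OF w] contr[OF w]] by metis
    moreover have "A \<omega> u = u" using fix_iff[OF w] u by auto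
    ultimately show ?thesis unfolding h_def by (simp add: limI)
  qed
  ultimately show ?thesis using that by blast
qed

section \<open>Conditional supports and their affine hulls\<close>

lemma reg_cond_distrD:
  assumes "reg_cond_distr M G X \<kappa>" "subalgebra M G"
  shows "\<And>\<omega>. \<omega> \<in> space G \<Longrightarrow> prob_space (\<kappa> \<omega>)" "\<And>\<omega>. \<omega> \<in> space G \<Longrightarrow> sets (\<kappa> \<omega>) = sets borel"
    "\<And>B. B \<in> sets borel \<Longrightarrow> (\<lambda>\<omega>. measure (\<kappa> \<omega>) B) \<in> borel_measurable G"
  using assms by (auto simp: reg_cond_distr_def subalgebra_def)

text \<open>Both sides say that a nonnegative quantity has vanishing integral, and the defining
  identity of the kernel equates the two integrals.\<close>

lemma reg_cond_distr_eq_0: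
  assumes M: "prob_space M" and sub: "subalgebra M G" and X: "X \<in> borel_measurable M"
    and \<kappa>: "reg_cond_distr M G X \<kappa>" and A: "A \<in> sets G" and B: "B \<in> sets borel"
  shows "(AE \<omega> in M. \<omega> \<in> A \<longrightarrow> measure (\<kappa> \<omega>) B = 0) \<longleftrightarrow> (AE \<omega> in M. \<omega> \<in> A \<longrightarrow> X \<omega> \<notin> B)"
proof -
  interpret prob_space M by fact
  have AM: "A \<in> sets M" using A sub by (auto simp: subalgebra_def)
  have XB: "X -` B \<inter> space M \<in> sets M" using measurable_sets[OF X B] .
  have meas: "(\<lambda>\<omega>. measure (\<kappa> \<omega>) B) \<in> borel_measurable M"
    using measurable_from_subalg[OF sub reg_cond_distrD(3)[OF \<kappa> sub B]] .
  have le1: "measure (\<kappa> \<omega>) B \<le> 1" if "\<omega> \<in> space M" for \<omega>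
    using \<kappa> that by (auto simp: reg_cond_distr_def intro!: prob_space.prob_le_1)
  have int: "integrable M (\<lambda>\<omega>. indicator A \<omega> * measure (\<kappa> \<omega>) B)"
    using meas AM le1 by (intro integrable_const_bound[of _ 1] AE_I2) (auto split: split_indicator)
  have "(AE \<omega> in M. \<omega> \<in> A \<longrightarrow> measure (\<kappa> \<omega>) B = 0) \<longleftrightarrow> (AE \<omega> in M. indicator A \<omega> * measure (\<kappa> \<omega>) B = 0)"
    by (intro AE_cong) (auto split: split_indicator)
  also have "\<dots> \<longleftrightarrow> (\<integral>\<omega>. indicator A \<omega> * measure (\<kappa> \<omega>) B \<partial>M) = 0"
    by (rule integral_nonneg_eq_0_iff_AE[OF int, symmetric]) auto
  also have "\<dots> \<longleftrightarrow> measure M (A \<inter> (X -` B \<inter> space M)) = 0"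
    using \<kappa> A B by (simp add: reg_cond_distr_def Int_assoc)
  also have "\<dots> \<longleftrightarrow> (AE \<omega> in M. \<omega> \<notin> A \<inter> (X -` B \<inter> space M))"
    using AM XB by (subst prob_eq_0) auto
  also have "\<dots> \<longleftrightarrow> (AE \<omega> in M. \<omega> \<in> A \<longrightarrow> X \<omega> \<notin> B)"
    by (intro AE_cong) auto
  finally show ?thesis .
qed

text \<open>For each basis set \<open>b\<close>, the set of \<open>\<omega>\<close> with
  \<open>measure (\<kappa> \<omega>) b = 0\<close> is an event of \<open>G\<close>, and on it
  \<open>X\<close> avoids \<open>b\<close> almost surely. Countably many basis sets cover the
  complement of the support.\<close>

lemma AE_in_support_reg_cond_distr:
  fixes X :: "'a \<Rightarrow> 'd::euclidean_space"
  assumes M: "prob_space M" and sub: "subalgebra M G" and X: "X \<in> borel_measurable M" and \<kappa>: "reg_cond_distr M G X \<kappa>"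
  shows "AE \<omega> in M. X \<omega> \<in> support (\<kappa> \<omega>)"
proof -
  interpret prob_space M by fact
  have spG: "space G = space M" using sub by (auto simp: subalgebra_def)
  obtain B :: "'d set set" where B: "countable B" "topological_basis B" using ex_countable_basis by blast
  have Bs: "b \<in> sets borel" if "b \<in> B" for b
    using topological_basis_open[OF B(2) that] by auto
  have "AE \<omega> in M. \<forall>b\<in>B. measure (\<kappa> \<omega>) b = 0 \<longrightarrow> X \<omega> \<notin> b"
  proof (subst AE_ball_countable[OF B(1)], intro ballI)
    fix b assume b: "b \<in> B"
    note [measurable] = reg_cond_distrD(3)[OF \<kappa> sub Bs[OF b]]
    have "{\<omega>\<in>space G. measure (\<kappa> \<omega>) b = 0} \<in> sets G" by measurable
    from reg_cond_distr_eq_0[OF M sub X \<kappa> this Bs[OF b]]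
    have "AE \<omega> in M. \<omega> \<in> {\<omega>\<in>space G. measure (\<kappa> \<omega>) b = 0} \<longrightarrow> X \<omega> \<notin> b" by auto
    with AE_space show "AE \<omega> in M. measure (\<kappa> \<omega>) b = 0 \<longrightarrow> X \<omega> \<notin> b"
      by eventually_elim (auto simp: spG)
  qed
  with AE_space show ?thesis
  proof eventually_elim
    case (elim \<omega>)
    note s = reg_cond_distrD(2)[OF \<kappa> sub, unfolded spG, OF elim(1)]
    interpret \<kappa>: prob_space "\<kappa> \<omega>" using reg_cond_distrD(1)[OF \<kappa> sub, unfolded spG, OF elim(1)] .
    show ?case unfolding support_def
    proof (intro CollectI allI impI)
      fix e :: real assume "e > 0"
      then obtain b where b: "b \<in> B" "X \<omega> \<in> b" "b \<subseteq> ball (X \<omega>) e"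
        using topological_basisE[OF B(2) open_ball, of "X \<omega>" "X \<omega>" e] by auto
      then have "measure (\<kappa> \<omega>) b \<noteq> 0" using elim by auto
      then have "emeasure (\<kappa> \<omega>) b > 0" by (auto simp: measure_def zero_less_iff_neq_zero)
      also have "emeasure (\<kappa> \<omega>) b \<le> emeasure (\<kappa> \<omega>) (ball (X \<omega>) e)" using b s by (intro emeasure_mono) auto
      finally show "0 < emeasure (\<kappa> \<omega>) (ball (X \<omega>) e)" .
    qed
  qed
qed

text \<open>The point \<open>c\<close> nearest to 0 works: the projection inequality holds for
  \<open>x\<close> and for its reflection \<open>2c - x\<close>, which an affine set also contains,
  and the two together force equality.\<close>

lemma affine_normal_vector:
  fixes S :: "'d::euclidean_space set"
  assumes "affine S" "S \<noteq> {}" "0 \<notin> S"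
  obtains c where "c \<noteq> 0" "\<And>x. x \<in> S \<Longrightarrow> c \<bullet> x = c \<bullet> c"
proof -
  define c where "c = closest_point S 0"
  have cl: "closed S" "convex S" using assms by (auto simp: affine_closed affine_imp_convex)
  have c: "c \<in> S" unfolding c_def using closest_point_in_set[OF cl(1) assms(2)] .
  have ge: "c \<bullet> x \<ge> c \<bullet> c" if "x \<in> S" for x
    using closest_point_dot[OF cl(2,1) that, of 0] by (simp add: c_def inner_diff_right)
  have "c \<bullet> x = c \<bullet> c" if x: "x \<in> S" for x
  proof -
    have "2 *\<^sub>R c + (-1) *\<^sub>R x \<in> S" by (rule mem_affine[OF assms(1) c x]) simp
    from ge[OF this] ge[OF x] show ?thesis by (simp add: inner_diff_right)
  qed
  moreover have "c \<noteq> 0" using c assms(3) by auto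
  ultimately show ?thesis using that by blast
qed

text \<open>The kernel projection is applied to \<open>x \<mapsto> (x, 1)\<close> and the vector \<open>(0, 1)\<close>: the component of \<open>(0, 1)\<close>
  orthogonal to all \<open>(x, 1)\<close> with \<open>x\<close> in the support is a measurable arbitrage wherever the affine hull misses \<open>0\<close>.\<close>

lemma no_arbitrage_imp_0_in_affine_hull_support:
  fixes X :: "'a \<Rightarrow> 'd::euclidean_space"
  assumes M: "prob_space M" and sub: "subalgebra M G" and X: "X \<in> borel_measurable M" and \<kappa>: "reg_cond_distr M G X \<kappa>"
    and na: "\<And>\<xi>. \<xi> \<in> borel_measurable G \<Longrightarrow> AE \<omega> in M. \<xi> \<omega> \<bullet> X \<omega> \<ge> 0 \<Longrightarrow> AE \<omega> in M. \<xi> \<omega> \<bullet> X \<omega> = 0"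
  shows "AE \<omega> in M. 0 \<in> affine hull (support (\<kappa> \<omega>))"
proof -
  have spG: "space G = space M" using sub by (auto simp: subalgebra_def)
  obtain h where h[measurable]: "h \<in> borel_measurable G"
    and h0: "\<And>\<omega> x. \<omega> \<in> space G \<Longrightarrow> x \<in> support (\<kappa> \<omega>) \<Longrightarrow> h \<omega> \<bullet> (x, 1::real) = 0"
    and h1: "\<And>\<omega> u. \<omega> \<in> space G \<Longrightarrow> (\<And>x. x \<in> support (\<kappa> \<omega>) \<Longrightarrow> u \<bullet> (x, 1) = 0) \<Longrightarrow> ((0, 1) - h \<omega>) \<bullet> u = 0"
    by (rule kernel_orthogonal_projection[OF reg_cond_distrD[OF \<kappa> sub], of "\<lambda>x. (x, 1::real)" "\<lambda>_. (0, 1)"])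
       (auto intro!: continuous_intros)
  \<comment> \<open>\<open>h\<close> itself annihilates all vectors \<open>(x, 1)\<close> over the
    support, so it may serve as \<open>u\<close> in \<open>h1\<close>. Hence the gain of
    \<open>- fst h\<close> is the squared norm of \<open>h\<close>, which is nonnegative and
    vanishes only with \<open>h\<close>.\<close>
  have hh: "snd (h \<omega>) = h \<omega> \<bullet> h \<omega>" if "\<omega> \<in> space G" for \<omega>
  proof -
    have "((0, 1) - h \<omega>) \<bullet> h \<omega> = 0" using h0 that by (intro h1) auto
    then show ?thesis by (simp add: inner_diff_left) (simp add: inner_prod_def)
  qed
  have "AE \<omega> in M. X \<omega> \<in> support (\<kappa> \<omega>)" by (rule AE_in_support_reg_cond_distr[OF M sub X \<kappa>])
  with AE_space have *: "AE \<omega> in M. - fst (h \<omega>) \<bullet> X \<omega> = h \<omega> \<bullet> h \<omega>"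
  proof eventually_elim
    case (elim \<omega>)
    then have "fst (h \<omega>) \<bullet> X \<omega> + snd (h \<omega>) = 0" using h0[of \<omega> "X \<omega>"] by (simp add: spG inner_prod_def)
    then show ?case using hh[of \<omega>] elim spG by (metis add.commute add.inverse_inverse add_eq_0_iff inner_minus_left)
  qed
  then have "AE \<omega> in M. - fst (h \<omega>) \<bullet> X \<omega> \<ge> 0" by eventually_elim simp
  moreover have "(\<lambda>\<omega>. - fst (h \<omega>)) \<in> borel_measurable G"
  proof -
    have "continuous_on UNIV (\<lambda>z::'d \<times> real. - fst z)" by (intro continuous_intros)
    from measurable_compose[OF h borel_measurable_continuous_onI[OF this]] show ?thesis .
  qed
  ultimately have "AE \<omega> in M. - fst (h \<omega>) \<bullet> X \<omega> = 0" using na by blast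
  with * AE_space \<open>AE \<omega> in M. X \<omega> \<in> support (\<kappa> \<omega>)\<close> show ?thesis
  proof eventually_elim
    case (elim \<omega>)
    then have z: "h \<omega> = 0" by simp
    show ?case
    proof (rule ccontr)
      assume "0 \<notin> affine hull (support (\<kappa> \<omega>))"
      moreover have "affine hull (support (\<kappa> \<omega>)) \<noteq> {}" using elim by (auto simp: affine_hull_eq_empty)
      ultimately obtain c where c: "c \<noteq> 0" "\<And>x. x \<in> affine hull (support (\<kappa> \<omega>)) \<Longrightarrow> c \<bullet> x = c \<bullet> c"
        using affine_normal_vector[OF affine_affine_hull] by metis
      \<comment> \<open>The vector \<open>(c, - (c \<bullet> c))\<close> annihilates every
        \<open>(x, 1)\<close>. With \<open>h = 0\<close> it would have to be orthogonal to
        \<open>(0, 1)\<close>, that is \<open>c \<bullet> c = 0\<close>.\<close>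
      have "((0, 1) - h \<omega>) \<bullet> (c, - (c \<bullet> c)) = 0"
        by (rule h1) (use elim spG c(2) hull_inc[of _ "support (\<kappa> \<omega>)" affine] in auto)
      then show False using c(1) z by simp
    qed
  qed
qed

text \<open>Subtracting the component \<open>h\<close> orthogonal to the support changes no inner
  product with the hull. That the hull contains 0 makes it the linear span, which is where the
  remainder lies.\<close>

lemma predictable_projection:
  fixes X :: "'a \<Rightarrow> 'd::euclidean_space"
  assumes M: "prob_space M" and sub: "subalgebra M G" and X: "X \<in> borel_measurable M" and \<kappa>: "reg_cond_distr M G X \<kappa>"
    and 0: "AE \<omega> in M. 0 \<in> affine hull (support (\<kappa> \<omega>))" and \<phi>: "\<phi> \<in> borel_measurable G"
  obtains \<psi> where "\<psi> \<in> borel_measurable G" "AE \<omega> in M. \<psi> \<omega> \<in> affine hull (support (\<kappa> \<omega>))"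
    "AE \<omega> in M. \<forall>x\<in>affine hull (support (\<kappa> \<omega>)). \<psi> \<omega> \<bullet> x = \<phi> \<omega> \<bullet> x"
proof -
  have spG: "space G = space M" using sub by (auto simp: subalgebra_def)
  obtain h where h[measurable]: "h \<in> borel_measurable G"
    and h0: "\<And>\<omega> x. \<omega> \<in> space G \<Longrightarrow> x \<in> support (\<kappa> \<omega>) \<Longrightarrow> h \<omega> \<bullet> x = 0"
    and h1: "\<And>\<omega> u. \<omega> \<in> space G \<Longrightarrow> (\<And>x. x \<in> support (\<kappa> \<omega>) \<Longrightarrow> u \<bullet> x = 0) \<Longrightarrow> (\<phi> \<omega> - h \<omega>) \<bullet> u = 0"
    by (rule kernel_orthogonal_projection[OF reg_cond_distrD[OF \<kappa> sub], of "\<lambda>x. x" \<phi>])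
       (use \<phi> in \<open>auto intro!: continuous_intros\<close>)
  show ?thesis
  proof (rule that)
    show "(\<lambda>\<omega>. \<phi> \<omega> - h \<omega>) \<in> borel_measurable G" using \<phi> by measurable
    show "AE \<omega> in M. \<forall>x\<in>affine hull (support (\<kappa> \<omega>)). (\<phi> \<omega> - h \<omega>) \<bullet> x = \<phi> \<omega> \<bullet> x"
    proof (rule AE_I2, rule ballI)
      fix \<omega> x assume "\<omega> \<in> space M" "x \<in> affine hull (support (\<kappa> \<omega>))"
      moreover have "affine hull (support (\<kappa> \<omega>)) \<subseteq> {x. h \<omega> \<bullet> x = 0}"
        by (rule hull_minimal) (use h0 \<open>\<omega> \<in> space M\<close> spG affine_hyperplane in auto)
      ultimately show "(\<phi> \<omega> - h \<omega>) \<bullet> x = \<phi> \<omega> \<bullet> x" by (auto simp: inner_diff_left)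
    qed
    show "AE \<omega> in M. \<phi> \<omega> - h \<omega> \<in> affine hull (support (\<kappa> \<omega>))"
      using 0 AE_space
    proof eventually_elim
      case (elim \<omega>)
      let ?S = "support (\<kappa> \<omega>)"
      have eq: "affine hull ?S = span ?S" using affine_hull_span_0[of ?S] elim by simp
      \<comment> \<open>The part \<open>z\<close> orthogonal to the span is a legitimate
        \<open>u\<close> in \<open>h1\<close>, so it is orthogonal to \<open>\<phi> - h\<close> and
        therefore to itself.\<close>
      obtain y z where yz: "y \<in> span ?S" "\<And>w. w \<in> span ?S \<Longrightarrow> orthogonal z w" "\<phi> \<omega> - h \<omega> = y + z"
        using orthogonal_subspace_decomp_exists[of ?S "\<phi> \<omega> - h \<omega>"] by metis
      have "(\<phi> \<omega> - h \<omega>) \<bullet> z = 0" by (rule h1) (use elim spG yz(2) span_base[of _ ?S] in \<open>auto simp: orthogonal_def\<close>)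
      moreover have "y \<bullet> z = 0" using yz(1,2) by (auto simp: orthogonal_def inner_commute)
      ultimately have "z \<bullet> z = 0" using yz(3) by (simp add: inner_add_left)
      then show ?case using yz eq by simp
    qed
  qed
qed

section \<open>Essential infima and moments\<close>

text \<open>\<open>ess_inf_fam\<close> is a choice, so a greatest almost sure lower bound must be
  shown to exist for an uncountable family. Among infima over countable subfamilies one has the
  smallest integral; adjoining a further member cannot lower it, so the infimum already lies below
  that member almost surely.\<close>

lemma ess_inf_fam_le:
  assumes M: "prob_space M" and i: "i \<in> I" and Y: "\<And>i. i \<in> I \<Longrightarrow> Y i \<in> borel_measurable M"
    and Y0: "\<And>i. i \<in> I \<Longrightarrow> AE \<omega> in M. 0 \<le> Y i \<omega>" and Y1: "\<And>i. i \<in> I \<Longrightarrow> AE \<omega> in M. Y i \<omega> \<le> 1"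
  shows "AE \<omega> in M. ess_inf_fam M Y I \<omega> \<le> Y i \<omega>"
proof -
  interpret prob_space M by fact
  define Z where "Z J \<omega> = (INF j\<in>J. Y j \<omega>)" for J \<omega>
  define C where "C = {J. J \<subseteq> I \<and> countable J \<and> J \<noteq> {}}"
  define \<Phi> where "\<Phi> J = (\<integral>\<^sup>+ \<omega>. e2ennreal (Z J \<omega>) \<partial>M)" for J
  have Zm[measurable]: "Z J \<in> borel_measurable M" if "J \<in> C" for J
    unfolding Z_def using that Y by (intro borel_measurable_INF) (auto simp: C_def)
  have mono: "\<Phi> J \<le> \<Phi> K" if "K \<subseteq> J" for J K
    unfolding \<Phi>_def Z_def by (intro nn_integral_mono e2ennreal_mono INF_superset_mono that order_refl)
  have "{i} \<in> C" using i by (auto simp: C_def)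
  then have "\<Phi> ` C \<noteq> {}" by auto
  from ennreal_Inf_countable_INF[OF this] obtain f :: "nat \<Rightarrow> ennreal"
    where f: "range f \<subseteq> \<Phi> ` C" "Inf (\<Phi> ` C) = (INF n. f n)" by auto
  then have "\<exists>J. J \<in> C \<and> f n = \<Phi> J" for n by auto
  then obtain J where J: "\<And>n::nat. J n \<in> C" "\<And>n. f n = \<Phi> (J n)" by metis
  \<comment> \<open>The union of the subfamilies along a minimising sequence is still countable and
    attains the minimum.\<close>
  define K where "K = (\<Union>n. J n)"
  have K: "K \<in> C" using J(1) unfolding C_def K_def by auto
  have Kmin: "\<Phi> K \<le> \<Phi> J'" if "J' \<in> C" for J'
  proof -
    have "\<Phi> K \<le> f n" for n unfolding J(2) by (rule mono) (auto simp: K_def)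
    then have "\<Phi> K \<le> Inf (\<Phi> ` C)" unfolding f(2) by (intro INF_greatest)
    then show ?thesis using that by (meson INF_lower order_trans)
  qed
  have le: "AE \<omega> in M. Z K \<omega> \<le> Y j \<omega>" if j: "j \<in> I" for j
  proof -
    \<comment> \<open>The upper bound 1 keeps the integrals finite, so they can be subtracted; the
      lower bound 0 makes the passage to \<open>ennreal\<close> lossless.\<close>
    have jK: "insert j K \<in> C" using K j by (auto simp: C_def)
    have Z0: "AE \<omega> in M. 0 \<le> Z K \<omega>"
    proof -
      have "AE \<omega> in M. \<forall>k\<in>K. 0 \<le> Y k \<omega>" using K Y0 by (subst AE_ball_countable) (auto simp: C_def)
      then show ?thesis by eventually_elim (auto simp: Z_def intro: INF_greatest)
    qed
    have Z1: "AE \<omega> in M. Z (insert j K) \<omega> \<le> 1"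
      using Y1[OF j] by eventually_elim (auto simp: Z_def intro: min.coboundedI1)
    have "\<Phi> (insert j K) \<le> (\<integral>\<^sup>+ \<omega>. 1 \<partial>M)" unfolding \<Phi>_def
    proof (rule nn_integral_mono_AE)
      show "AE \<omega> in M. e2ennreal (Z (insert j K) \<omega>) \<le> 1"
        using Z1 by eventually_elim (metis e2ennreal_mono e2ennreal_ereal ennreal_1 one_ereal_def)
    qed
    then have fin: "\<Phi> (insert j K) \<noteq> \<infinity>" by (simp add: emeasure_space_1 top_unique less_top[symmetric]) (metis ennreal_one_neq_top top_unique)
    have "(\<integral>\<^sup>+ \<omega>. e2ennreal (Z K \<omega>) - e2ennreal (Z (insert j K) \<omega>) \<partial>M) = \<Phi> K - \<Phi> (insert j K)"
      unfolding \<Phi>_def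
    proof (rule nn_integral_diff)
      show "AE \<omega> in M. e2ennreal (Z (insert j K) \<omega>) \<le> e2ennreal (Z K \<omega>)"
        by (intro AE_I2 e2ennreal_mono) (auto simp: Z_def)
    qed (use fin K jK in \<open>auto simp: \<Phi>_def\<close>)
    also have "\<dots> = 0" using Kmin[OF jK] by (simp add: diff_eq_0_iff_ennreal)
        (metis fin infinity_ennreal_def le_less_trans less_top)
    finally have "AE \<omega> in M. e2ennreal (Z K \<omega>) - e2ennreal (Z (insert j K) \<omega>) = 0"
      using K jK by (subst (asm) nn_integral_0_iff_AE) auto
    with Z0 Y0[OF j] show ?thesis
    proof eventually_elim
      case (elim \<omega>)
      have "e2ennreal (Z K \<omega>) \<le> e2ennreal (Z (insert j K) \<omega>)" using elim(3) by (auto simp: diff_eq_0_iff_ennreal)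
      also have "\<dots> \<le> e2ennreal (Y j \<omega>)" by (intro e2ennreal_mono) (auto simp: Z_def)
      finally show ?case using elim by (metis enn2ereal_e2ennreal less_eq_ennreal.rep_eq)
    qed
  qed
  have "\<exists>Z. Z \<in> borel_measurable M \<and> (\<forall>i\<in>I. AE \<omega> in M. Z \<omega> \<le> Y i \<omega>) \<and>
      (\<forall>Z'. Z' \<in> borel_measurable M \<and> (\<forall>i\<in>I. AE \<omega> in M. Z' \<omega> \<le> Y i \<omega>) \<longrightarrow>
            (AE \<omega> in M. Z' \<omega> \<le> Z \<omega>))"
  proof (intro exI[of _ "Z K"] conjI ballI le allI impI Zm[OF K])
    fix Z' assume Z': "Z' \<in> borel_measurable M \<and> (\<forall>i\<in>I. AE \<omega> in M. Z' \<omega> \<le> Y i \<omega>)"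
    then have "AE \<omega> in M. \<forall>k\<in>K. Z' \<omega> \<le> Y k \<omega>" using K by (subst AE_ball_countable) (auto simp: C_def)
    then show "AE \<omega> in M. Z' \<omega> \<le> Z K \<omega>" by eventually_elim (auto simp: Z_def intro: INF_greatest)
  qed
  from someI_ex[OF this] show ?thesis using i unfolding ess_inf_fam_def by blast
qed

section \<open>Random variables with all moments\<close>

lemma filtered_prob_spaceD:
  assumes "filtered_prob_space M F T"
  shows "prob_space M" "\<And>t. t \<le> T \<Longrightarrow> subalgebra M (F t)"
    "\<And>s t. s \<le> t \<Longrightarrow> t \<le> T \<Longrightarrow> subalgebra (F t) (F s)"
  using assms by (auto simp: filtered_prob_space_def subalgebra_def)

lemma Wclass_measurable:
  assumes "filtered_prob_space M F T" "X \<in> Wclass M F T"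
  shows "X \<in> borel_measurable M"
  using measurable_from_subalg[OF filtered_prob_spaceD(2)[OF assms(1) order_refl]] assms(2)
  by (auto simp: Wclass_def)

lemma Wclass_integrable:
  assumes "filtered_prob_space M F T" "X \<in> Wclass M F T"
  shows "integrable M X"
proof -
  have "\<forall>p::real>0. integrable M (\<lambda>\<omega>. \<bar>X \<omega>\<bar> powr p)" using assms(2) unfolding Wclass_def by blast
  from this[rule_format, of 1] have "integrable M (\<lambda>\<omega>. \<bar>X \<omega>\<bar>)" by simp
  then show ?thesis using Wclass_measurable[OF assms] by (intro integrable_norm_cancel[of M X]) auto
qed

lemma Wclass_const:
  assumes "filtered_prob_space M F T"
  shows "(\<lambda>_. c) \<in> Wclass M F T"
proof -
  interpret prob_space M using filtered_prob_spaceD(1)[OF assms] .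
  show ?thesis by (auto simp: Wclass_def)
qed

text \<open>Closure under products needs moments of all orders: the exponent \<open>p\<close> of the
  product is controlled by the exponent \<open>2 * p\<close> of the factors.\<close>

lemma Wclass_mult:
  assumes F: "filtered_prob_space M F T" and X: "X \<in> Wclass M F T" and Y: "Y \<in> Wclass M F T"
  shows "(\<lambda>\<omega>. X \<omega> * Y \<omega>) \<in> Wclass M F T"
proof -
  note [measurable] = Wclass_measurable[OF F X] Wclass_measurable[OF F Y]
  have "integrable M (\<lambda>\<omega>. \<bar>X \<omega> * Y \<omega>\<bar> powr p)" if p: "p > 0" for p
  proof (rule Bochner_Integration.integrable_bound)
    show "integrable M (\<lambda>\<omega>. \<bar>X \<omega>\<bar> powr (2 * p) + \<bar>Y \<omega>\<bar> powr (2 * p))"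
      using X Y p by (auto simp: Wclass_def)
    have *: "\<bar>x * y\<bar> powr p \<le> \<bar>x\<bar> powr (2 * p) + \<bar>y\<bar> powr (2 * p)" for x y :: real
    proof -
      have sq: "\<bar>z\<bar> powr (2 * p) = (\<bar>z\<bar> powr p)\<^sup>2" for z :: real
        by (simp add: power2_eq_square powr_add[symmetric])
      have "2 * \<bar>x\<bar> powr p * \<bar>y\<bar> powr p \<le> (\<bar>x\<bar> powr p)\<^sup>2 + (\<bar>y\<bar> powr p)\<^sup>2" by (rule sum_squares_bound)
      then have "2 * (\<bar>x\<bar> powr p * \<bar>y\<bar> powr p) \<le> (\<bar>x\<bar> powr p)\<^sup>2 + (\<bar>y\<bar> powr p)\<^sup>2" by (simp add: mult.assoc)
      moreover have "0 \<le> \<bar>x\<bar> powr p * \<bar>y\<bar> powr p" by simp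
      ultimately have "\<bar>x\<bar> powr p * \<bar>y\<bar> powr p \<le> (\<bar>x\<bar> powr p)\<^sup>2 + (\<bar>y\<bar> powr p)\<^sup>2" by linarith
      then show ?thesis unfolding sq abs_mult by (simp add: powr_mult)
    qed
    show "AE \<omega> in M. norm (\<bar>X \<omega> * Y \<omega>\<bar> powr p) \<le> norm (\<bar>X \<omega>\<bar> powr (2 * p) + \<bar>Y \<omega>\<bar> powr (2 * p))"
      using * by (intro AE_I2) (auto intro: order_trans)
  qed measurable
  then show ?thesis using X Y by (auto simp: Wclass_def)
qed

lemma Wclass_add:
  assumes F: "filtered_prob_space M F T" and X: "X \<in> Wclass M F T" and Y: "Y \<in> Wclass M F T"
  shows "(\<lambda>\<omega>. X \<omega> + Y \<omega>) \<in> Wclass M F T"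
proof -
  note [measurable] = Wclass_measurable[OF F X] Wclass_measurable[OF F Y]
  have "integrable M (\<lambda>\<omega>. \<bar>X \<omega> + Y \<omega>\<bar> powr p)" if p: "p > 0" for p
  proof (rule Bochner_Integration.integrable_bound)
    show "integrable M (\<lambda>\<omega>. 2 powr p * (\<bar>X \<omega>\<bar> powr p + \<bar>Y \<omega>\<bar> powr p))"
      using X Y p by (auto simp: Wclass_def)
    have *: "\<bar>x + y\<bar> powr p \<le> 2 powr p * (\<bar>x\<bar> powr p + \<bar>y\<bar> powr p)" for x y :: real
    proof -
      have "\<bar>x + y\<bar> powr p \<le> (2 * max \<bar>x\<bar> \<bar>y\<bar>) powr p" using p by (intro powr_mono2) auto
      also have "\<dots> = 2 powr p * max \<bar>x\<bar> \<bar>y\<bar> powr p" by (simp add: powr_mult)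
      also have "\<dots> \<le> 2 powr p * (\<bar>x\<bar> powr p + \<bar>y\<bar> powr p)" by (intro mult_left_mono) (auto simp: max_def)
      finally show ?thesis .
    qed
    show "AE \<omega> in M. norm (\<bar>X \<omega> + Y \<omega>\<bar> powr p) \<le> norm (2 powr p * (\<bar>X \<omega>\<bar> powr p + \<bar>Y \<omega>\<bar> powr p))"
      using * by (intro AE_I2) (simp del: distrib_left)
  qed measurable
  then show ?thesis using X Y by (auto simp: Wclass_def)
qed

lemma Wclass_prod:
  assumes F: "filtered_prob_space M F T" and "\<And>i. i \<in> A \<Longrightarrow> X i \<in> Wclass M F T"
  shows "(\<lambda>\<omega>. \<Prod>i\<in>A. X i \<omega>) \<in> Wclass M F T"
  using assms(2) by (induction A rule: infinite_finite_induct) (auto intro: Wclass_const[OF F] Wclass_mult[OF F])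

section \<open>Dominated extended expectations\<close>

text \<open>An integrable majorant rules out the undefined case and leaves a single nonnegative
  integral, possibly infinite. Monotonicity, additivity and Fatou's lemma for such integrals then
  become available.\<close>

lemma ext_expectation_dominated:
  assumes X[measurable]: "X \<in> borel_measurable M" and L: "integrable M L" and L0: "\<And>\<omega>. 0 \<le> L \<omega>"
    and le: "AE \<omega> in M. X \<omega> \<le> ereal (L \<omega>)"
  shows "ext_expectation M X = ereal (\<integral>\<omega>. L \<omega> \<partial>M) - enn2ereal (\<integral>\<^sup>+ \<omega>. e2ennreal (ereal (L \<omega>) - X \<omega>) \<partial>M)"
proof -
  note [measurable] = borel_measurable_integrable[OF L]
  define p n q where "p = (\<integral>\<^sup>+ \<omega>. e2ennreal (X \<omega>) \<partial>M)" and "n = (\<integral>\<^sup>+ \<omega>. e2ennreal (- X \<omega>) \<partial>M)"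
    and "q = (\<integral>\<^sup>+ \<omega>. e2ennreal (ereal (L \<omega>) - X \<omega>) \<partial>M)"
  define l where "l = (\<integral>\<omega>. L \<omega> \<partial>M)"
  have l0: "0 \<le> l" unfolding l_def using L0 by simp
  have l: "(\<integral>\<^sup>+ \<omega>. ennreal (L \<omega>) \<partial>M) = ennreal l"
    unfolding l_def by (rule nn_integral_eq_integral[OF L]) (simp add: L0)
  \<comment> \<open>This is the decomposition of \<open>X\<close> into positive and negative part,
    arranged so that no subtraction of possibly infinite terms occurs.\<close>
  have "AE \<omega> in M. e2ennreal (ereal (L \<omega>) - X \<omega>) + e2ennreal (X \<omega>) = ennreal (L \<omega>) + e2ennreal (- X \<omega>)"
    using le
  proof eventually_elim
    case (elim \<omega>)
    show ?case
    proof (cases "X \<omega>")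
      case (real x)
      then have "x \<le> L \<omega>" using elim by simp
      show ?thesis
      proof (cases "x \<ge> 0")
        case True
        then show ?thesis using real \<open>x \<le> L \<omega>\<close> by (simp add: ennreal_plus[symmetric] ennreal_neg del: ennreal_plus)
      next
        case False
        then show ?thesis using real \<open>x \<le> L \<omega>\<close> L0[of \<omega>] by (simp add: ennreal_plus[symmetric] ennreal_neg del: ennreal_plus)
      qed
    qed (use elim in \<open>auto simp: e2ennreal_neg\<close>)
  qed
  then have "(\<integral>\<^sup>+ \<omega>. e2ennreal (ereal (L \<omega>) - X \<omega>) + e2ennreal (X \<omega>) \<partial>M) = (\<integral>\<^sup>+ \<omega>. ennreal (L \<omega>) + e2ennreal (- X \<omega>) \<partial>M)"
    by (rule nn_integral_cong_AE)
  then have eq: "q + p = ennreal l + n"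
    unfolding p_def n_def q_def l[symmetric] by (simp add: nn_integral_add)
  have "p \<le> ennreal l" unfolding p_def l[symmetric]
    by (rule nn_integral_mono_AE, use le in eventually_elim) (metis e2ennreal_ereal e2ennreal_mono)
  then have p: "p < \<infinity>" by (metis ennreal_less_top infinity_ennreal_def le_less_trans)
  have "enn2ereal p - enn2ereal n = ereal l - enn2ereal q"
  proof (cases p)
    case (real p')
    show ?thesis
    proof (cases n)
      case (real n')
      then have "q \<noteq> \<infinity>" using eq \<open>p = ennreal p'\<close> by (auto simp: ennreal_plus[symmetric] l0 simp del: ennreal_plus)
      then obtain q' where q': "q = ennreal q'" "0 \<le> q'" by (cases q) auto
      have "q' + p' = l + n'"
        using eq real q' \<open>p = ennreal p'\<close> \<open>0 \<le> p'\<close> l0 by (simp add: ennreal_plus[symmetric] del: ennreal_plus)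
      then show ?thesis using real q' \<open>p = ennreal p'\<close> \<open>0 \<le> p'\<close> by (simp add: enn2ereal_ennreal)
    next
      case top
      then have "q = top" using eq \<open>p = ennreal p'\<close> by (cases q) (auto simp: ennreal_plus[symmetric] simp del: ennreal_plus)
      then show ?thesis using top \<open>p = ennreal p'\<close> \<open>0 \<le> p'\<close> by (simp add: enn2ereal_ennreal)
    qed
  qed (use p in auto)
  then show ?thesis using p unfolding ext_expectation_def Let_def p_def[symmetric] n_def[symmetric] q_def[symmetric] l_def by auto
qed

text \<open>Superlevel sets of the expectation become sublevel sets of the integrated gap
  \<open>L - X\<close>, the form in which they are seen to be convex and closed.\<close>

lemma le_ext_expectation_dominated_iff:
  assumes "X \<in> borel_measurable M" "integrable M L" "\<And>\<omega>. 0 \<le> L \<omega>" "AE \<omega> in M. X \<omega> \<le> ereal (L \<omega>)"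
  shows "ereal c \<le> ext_expectation M X \<longleftrightarrow>
    c \<le> (\<integral>\<omega>. L \<omega> \<partial>M) \<and> (\<integral>\<^sup>+ \<omega>. e2ennreal (ereal (L \<omega>) - X \<omega>) \<partial>M) \<le> ennreal ((\<integral>\<omega>. L \<omega> \<partial>M) - c)"
proof -
  define q l where "q = (\<integral>\<^sup>+ \<omega>. e2ennreal (ereal (L \<omega>) - X \<omega>) \<partial>M)" and "l = (\<integral>\<omega>. L \<omega> \<partial>M)"
  have "ext_expectation M X = ereal l - enn2ereal q"
    unfolding q_def l_def using ext_expectation_dominated[OF assms] .
  moreover have "ereal c \<le> ereal l - enn2ereal q \<longleftrightarrow> c \<le> l \<and> q \<le> ennreal (l - c)"
    by (cases q) (auto simp: enn2ereal_ennreal top_unique ennreal_le_iff2)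
  ultimately show ?thesis unfolding q_def l_def by simp
qed

lemma ext_expectation_dominated_le:
  assumes "X \<in> borel_measurable M" "integrable M L" "\<And>\<omega>. 0 \<le> L \<omega>" "AE \<omega> in M. X \<omega> \<le> ereal (L \<omega>)"
  shows "ext_expectation M X \<le> ereal (\<integral>\<omega>. L \<omega> \<partial>M)"
proof -
  define q l where "q = (\<integral>\<^sup>+ \<omega>. e2ennreal (ereal (L \<omega>) - X \<omega>) \<partial>M)" and "l = (\<integral>\<omega>. L \<omega> \<partial>M)"
  have "ext_expectation M X = ereal l - enn2ereal q"
    unfolding q_def l_def using ext_expectation_dominated[OF assms] .
  then show ?thesis unfolding l_def[symmetric] by (cases q) (auto simp: enn2ereal_ennreal)
qed

text \<open>Concavity doubles the gap \<open>L - Z\<close> to at most the sum of the gaps of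
  \<open>X\<close> and \<open>Y\<close>. A gap is infinite exactly where the variable is minus
  infinity, where nothing is to be shown; the level plus infinity is excluded by domination.\<close>

lemma ext_expectation_midpoint:
  assumes X: "X \<in> borel_measurable M" "AE \<omega> in M. X \<omega> \<le> ereal (L \<omega>)"
    and Y: "Y \<in> borel_measurable M" "AE \<omega> in M. Y \<omega> \<le> ereal (L \<omega>)"
    and Z: "Z \<in> borel_measurable M" "AE \<omega> in M. Z \<omega> \<le> ereal (L \<omega>)"
    and L: "integrable M L" "\<And>\<omega>. 0 \<le> L \<omega>"
    and mid: "AE \<omega> in M. ereal (1/2) * X \<omega> + ereal (1/2) * Y \<omega> \<le> Z \<omega>"
    and c: "c \<le> ext_expectation M X" "c \<le> ext_expectation M Y"
  shows "c \<le> ext_expectation M Z"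
proof (cases c)
  case (real r)
  note [measurable] = X(1) Y(1) Z(1) borel_measurable_integrable[OF L(1)]
  let ?q = "\<lambda>X. \<integral>\<^sup>+ \<omega>. e2ennreal (ereal (L \<omega>) - X \<omega>) \<partial>M"
  let ?b = "ennreal ((\<integral>\<omega>. L \<omega> \<partial>M) - r)"
  have b: "r \<le> (\<integral>\<omega>. L \<omega> \<partial>M)" "?q X \<le> ?b" "?q Y \<le> ?b"
    using c[unfolded real] le_ext_expectation_dominated_iff[OF X(1) L X(2)] le_ext_expectation_dominated_iff[OF Y(1) L Y(2)] by auto
  have "2 * ?q Z = (\<integral>\<^sup>+ \<omega>. 2 * e2ennreal (ereal (L \<omega>) - Z \<omega>) \<partial>M)" by (simp add: nn_integral_cmult)
  also have "\<dots> \<le> (\<integral>\<^sup>+ \<omega>. e2ennreal (ereal (L \<omega>) - X \<omega>) + e2ennreal (ereal (L \<omega>) - Y \<omega>) \<partial>M)"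
  proof (rule nn_integral_mono_AE)
    show "AE \<omega> in M. 2 * e2ennreal (ereal (L \<omega>) - Z \<omega>) \<le> e2ennreal (ereal (L \<omega>) - X \<omega>) + e2ennreal (ereal (L \<omega>) - Y \<omega>)"
      using mid X(2) Y(2) Z(2)
    proof eventually_elim
      case (elim \<omega>)
      show ?case
      proof (cases "X \<omega>")
        case x: (real x)
        show ?thesis
        proof (cases "Y \<omega>")
          case y: (real y)
          show ?thesis
          proof (cases "Z \<omega>")
            case z: (real z)
            have "2 * ennreal (L \<omega> - z) = ennreal (2 * (L \<omega> - z))"
              using elim z by (subst ennreal_mult) auto
            also have "\<dots> \<le> ennreal ((L \<omega> - x) + (L \<omega> - y))" using elim x y z by (intro ennreal_leI) simp
            also have "\<dots> = ennreal (L \<omega> - x) + ennreal (L \<omega> - y)" using elim x y by (intro ennreal_plus) auto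
            finally show ?thesis using x y z by simp
          qed (use elim x y in auto)
        qed (use elim in auto)
      qed (use elim in auto)
    qed
  qed
  also have "\<dots> = ?q X + ?q Y" by (simp add: nn_integral_add)
  also have "\<dots> \<le> ?b + ?b" using b by (intro add_mono)
  also have "\<dots> = 2 * ?b" by (simp add: mult_2)
  finally have "?q Z \<le> ?b" by (simp add: ennreal_mult_le_mult_iff)
  then show ?thesis unfolding real using b(1) le_ext_expectation_dominated_iff[OF Z(1) L Z(2)] by auto
next
  case PInf
  then show ?thesis using c(1) ext_expectation_dominated_le[OF X(1) L X(2)] by simp
qed simp

text \<open>The hypothesis \<open>lim\<close> states that the upper limit of \<open>X k\<close> is
  at most \<open>Y\<close>, in the form that semicontinuity of the utility delivers. The gaps
  \<open>L - X k\<close> are nonnegative almost surely and their lower limit dominates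
  \<open>L - Y\<close>, so Fatou's lemma applies.\<close>

lemma ext_expectation_fatou:
  assumes X: "\<And>k. X k \<in> borel_measurable M" "\<And>k. AE \<omega> in M. X k \<omega> \<le> ereal (L \<omega>)"
    and Y: "Y \<in> borel_measurable M" "AE \<omega> in M. Y \<omega> \<le> ereal (L \<omega>)"
    and L: "integrable M L" "\<And>\<omega>. 0 \<le> L \<omega>"
    and lim: "AE \<omega> in M. \<forall>c>Y \<omega>. \<forall>\<^sub>F k in sequentially. X k \<omega> < c"
    and c: "\<And>k. m \<le> k \<Longrightarrow> c \<le> ext_expectation M (X k)"
  shows "c \<le> ext_expectation M Y"
proof (cases c)
  case (real r)
  note [measurable] = X(1) Y(1) borel_measurable_integrable[OF L(1)]
  let ?q = "\<lambda>X. \<integral>\<^sup>+ \<omega>. e2ennreal (ereal (L \<omega>) - X \<omega>) \<partial>M"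
  let ?b = "ennreal ((\<integral>\<omega>. L \<omega> \<partial>M) - r)"
  have b: "r \<le> (\<integral>\<omega>. L \<omega> \<partial>M)" "\<And>k. m \<le> k \<Longrightarrow> ?q (X k) \<le> ?b"
    using c[unfolded real] le_ext_expectation_dominated_iff[OF X(1) L X(2)] by auto
  \<comment> \<open>Truncation at 0 by \<open>e2ennreal\<close> is harmless for comparisons with a
    nonnegative threshold.\<close>
  have less: "ennreal y < e2ennreal (ereal l - x) \<longleftrightarrow> x < ereal (l - y)" if "0 \<le> y" for x y l
    using that by (cases x) (auto simp: ennreal_less_iff e2ennreal_neg)
  have "?q Y \<le> (\<integral>\<^sup>+ \<omega>. liminf (\<lambda>k. e2ennreal (ereal (L \<omega>) - X k \<omega>)) \<partial>M)"
  proof (rule nn_integral_mono_AE)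
    show "AE \<omega> in M. e2ennreal (ereal (L \<omega>) - Y \<omega>) \<le> liminf (\<lambda>k. e2ennreal (ereal (L \<omega>) - X k \<omega>))"
      using lim
    proof eventually_elim
      case (elim \<omega>)
      show ?case unfolding le_Liminf_iff
      proof (intro allI impI)
        fix y assume y: "y < e2ennreal (ereal (L \<omega>) - Y \<omega>)"
        then obtain y' where y': "y = ennreal y'" "0 \<le> y'" by (cases y) auto
        then have "Y \<omega> < ereal (L \<omega> - y')" using y less by blast
        then have "\<forall>\<^sub>F k in sequentially. X k \<omega> < ereal (L \<omega> - y')" using elim by blast
        then show "\<forall>\<^sub>F k in sequentially. y < e2ennreal (ereal (L \<omega>) - X k \<omega>)"
          by eventually_elim (use y' less in blast)
      qed
    qed
  qed
  also have "\<dots> \<le> liminf (\<lambda>k. ?q (X k))" by (rule nn_integral_liminf) measurable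
  also have "\<dots> \<le> ?b"
    using b(2) by (intro Liminf_le eventually_sequentiallyI[of m]) auto
  finally show ?thesis unfolding real using b(1) le_ext_expectation_dominated_iff[OF Y(1) L Y(2)] by auto
next
  case PInf
  then show ?thesis using c[of m] ext_expectation_dominated_le[OF X(1) L X(2), of m] by simp
qed simp

section \<open>Semicontinuity and growth of the utility\<close>

lemma usc_borel_measurable: "usc U \<Longrightarrow> U \<in> borel_measurable borel"
  by (rule borel_measurableI_less) (auto simp: usc_def)

lemma usc_tendsto_less:
  assumes "usc U" "(f \<longlongrightarrow> l) F" "U l < c"
  shows "\<forall>\<^sub>F k in F. U (f k) < c"
  using topological_tendstoD[OF assms(2), of "{x. U x < c}"] assms(1,3) by (auto simp: usc_def)

text \<open>To the right of 1 a concave function lies below its chord through 1/2 and 1, whose slope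
  is \<open>2 * (v - u)\<close>; to the left monotonicity suffices. Absolute values make the
  intercept nonnegative.\<close>

lemma utility_linear_bound:
  assumes U: "utility_assumption U" and dom: "interior {x. U x > - \<infinity>} = {0<..}"
  obtains a b where "0 \<le> a" "0 \<le> b" "\<And>x. 0 \<le> x \<Longrightarrow> U x \<le> ereal (a + b * x)"
proof -
  have mono: "mono U" and conc: "concave_ext U" and fin: "\<And>x. U x \<noteq> \<infinity>" using U by (auto simp: utility_assumption_def)
  have "U x > - \<infinity>" if "x > 0" for x using that dom interior_subset[of "{x. U x > - \<infinity>}"] by auto
  then have ex: "\<exists>r. U x = ereal r" if "x > 0" for x using fin[of x] that by (cases "U x") force+
  obtain u where u: "U (1/2) = ereal u" using ex[of "1/2"] by auto
  obtain v where v: "U 1 = ereal v" using ex[of 1] by auto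
  have uv: "u \<le> v" using monoD[OF mono, of "1/2" 1] u v by simp
  have "U x \<le> ereal ((\<bar>u\<bar> + \<bar>v\<bar>) + (2 * (v - u)) * x)" if x0: "0 \<le> x" for x
  proof (cases "x \<le> 1")
    case True
    then have "U x \<le> ereal v" using monoD[OF mono, of x 1] v by simp
    also have "\<dots> \<le> ereal ((\<bar>u\<bar> + \<bar>v\<bar>) + (2 * (v - u)) * x)"     proof -
      have "0 \<le> 2 * (v - u) * x" using uv x0 by (intro mult_nonneg_nonneg) auto
      then have "v \<le> (\<bar>u\<bar> + \<bar>v\<bar>) + (2 * (v - u)) * x" by linarith
      then show ?thesis by (simp only: ereal_less_eq)
    qed
    finally show ?thesis .
  next
    case False
    \<comment> \<open>The weight that writes 1 as a convex combination of \<open>x\<close> and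
      1/2.\<close>
    define l where "l = 1 / (2 * x - 1)"
    have l: "0 < l" "l \<le> 1" using False by (auto simp: l_def)
    have lx: "l * x + (1 - l) * (1/2) = 1"     proof -
      have "l * (2 * x - 1) = 1" using False by (simp add: l_def)
      moreover have "l * x + (1 - l) * (1/2) = (l * (2 * x - 1) + 1) / 2" by (simp add: field_simps)
      ultimately show ?thesis by simp
    qed
    obtain y where y: "U x = ereal y" using ex[of x] False by auto
    have "ereal l * U x + ereal (1 - l) * U (1/2) \<le> U (l * x + (1 - l) * (1/2))"
      using conc l unfolding concave_ext_def by (meson less_imp_le)
    then have "l * y + (1 - l) * u \<le> v" unfolding lx using y u v by simp
    then have "l * (y - u) \<le> v - u" by (simp add: algebra_simps)
    then have "y - u \<le> (v - u) / l" using l by (simp add: field_simps)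
    also have "\<dots> = (2 * x - 1) * (v - u)" by (simp add: l_def)
    finally have "y \<le> (\<bar>u\<bar> + \<bar>v\<bar>) + (2 * (v - u)) * x" using uv by (simp add: algebra_simps)
    then show ?thesis by (simp add: y)
  qed
  then show ?thesis using that[of "\<bar>u\<bar> + \<bar>v\<bar>" "2 * (v - u)"] uv by auto
qed

section \<open>Almost minimisers\<close>

text \<open>The sum of the norms of the increments has finite expectation, so it is finite almost
  surely and the telescoping series converges absolutely.\<close>

lemma AE_convergent_if_summable_increments:
  fixes f :: "nat \<Rightarrow> 'a \<Rightarrow> 'd::euclidean_space"
  assumes int: "\<And>k. integrable M (\<lambda>\<omega>. f (Suc k) \<omega> - f k \<omega>)"
    and le: "\<And>k. (\<integral>\<omega>. norm (f (Suc k) \<omega> - f k \<omega>) \<partial>M) \<le> b k" and b: "summable b"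
  shows "AE \<omega> in M. convergent (\<lambda>k. f k \<omega>)"
proof -
  note [measurable] = borel_measurable_integrable[OF int]
  have b0: "0 \<le> b k" for k using order_trans[OF _ le[of k]] by simp
  have "(\<integral>\<^sup>+ \<omega>. (\<Sum>k. ennreal (norm (f (Suc k) \<omega> - f k \<omega>))) \<partial>M) = (\<Sum>k. \<integral>\<^sup>+ \<omega>. ennreal (norm (f (Suc k) \<omega> - f k \<omega>)) \<partial>M)"
    by (rule nn_integral_suminf) measurable
  also have "\<dots> = (\<Sum>k. ennreal (\<integral>\<omega>. norm (f (Suc k) \<omega> - f k \<omega>) \<partial>M))"
    by (intro suminf_cong nn_integral_eq_integral integrable_norm int) auto
  also have "\<dots> \<le> (\<Sum>k. ennreal (b k))" by (intro suminf_le ennreal_leI le) auto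
  also have "\<dots> = ennreal (\<Sum>k. b k)" using b0 b by (rule suminf_ennreal2)
  also have "\<dots> < \<infinity>" by simp
  finally have "AE \<omega> in M. (\<Sum>k. ennreal (norm (f (Suc k) \<omega> - f k \<omega>))) \<noteq> \<infinity>"
    by (intro nn_integral_PInf_AE) auto
  then show ?thesis
  proof eventually_elim
    case (elim \<omega>)
    then have "summable (\<lambda>k. norm (f (Suc k) \<omega> - f k \<omega>))"
      by (intro summable_suminf_not_top) auto
    then have "summable (\<lambda>k. f (Suc k) \<omega> - f k \<omega>)" by (rule summable_norm_cancel)
    then have "convergent (\<lambda>n. f n \<omega> - f 0 \<omega>)"
      unfolding summable_iff_convergent using sum_lessThan_telescope[of "\<lambda>k. f k \<omega>"] by simp
    then show ?case by (simp add: convergent_diff_const_right_iff)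
  qed
qed

text \<open>Almost minimisers of the \<open>L\<^sup>2\<close> norm over a decreasing sequence of bounded midpoint-convex sets form a
  fast Cauchy sequence by the parallelogram law; this replaces a Komlos-type subsequence argument.\<close>

lemma almost_minimizers_converge_AE:
  fixes C :: "nat \<Rightarrow> ('i \<Rightarrow> 'a \<Rightarrow> 'd::euclidean_space) set"
  assumes M: "finite_measure M" and I: "finite I"
    and dec: "decseq C" and ne: "\<And>n. C n \<noteq> {}"
    and meas: "\<And>\<phi> i. \<phi> \<in> C 0 \<Longrightarrow> i \<in> I \<Longrightarrow> \<phi> i \<in> borel_measurable M"
    and sq: "\<And>\<phi> i. \<phi> \<in> C 0 \<Longrightarrow> i \<in> I \<Longrightarrow> integrable M (\<lambda>\<omega>. (norm (\<phi> i \<omega>))\<^sup>2)"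
    and bdd: "\<And>\<phi>. \<phi> \<in> C 0 \<Longrightarrow> (\<Sum>i\<in>I. \<integral>\<omega>. (norm (\<phi> i \<omega>))\<^sup>2 \<partial>M) \<le> B"
    and mid: "\<And>n \<phi> \<psi>. \<phi> \<in> C n \<Longrightarrow> \<psi> \<in> C n \<Longrightarrow> (\<lambda>i \<omega>. (1/2) *\<^sub>R (\<phi> i \<omega> + \<psi> i \<omega>)) \<in> C n"
  obtains g where "\<And>k. g k \<in> C k" "AE \<omega> in M. \<forall>i\<in>I. convergent (\<lambda>k. g k i \<omega>)"
proof -
  interpret finite_measure M by fact
  define q where "q \<phi> = (\<Sum>i\<in>I. \<integral>\<omega>. (norm (\<phi> i \<omega>))\<^sup>2 \<partial>M)" for \<phi> :: "'i \<Rightarrow> 'a \<Rightarrow> 'd"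
  define d where "d n = (INF \<phi>\<in>C n. q \<phi>)" for n
  have C0: "\<phi> \<in> C 0" if "\<phi> \<in> C n" for \<phi> n using decseqD[OF dec, of 0 n] that by auto
  have q0: "0 \<le> q \<phi>" for \<phi> unfolding q_def by (intro sum_nonneg) auto
  have bb: "bdd_below (q ` X)" for X using q0 by (intro bdd_belowI[of _ 0]) auto
  have d_le: "d n \<le> q \<phi>" if "\<phi> \<in> C n" for n \<phi> unfolding d_def using that bb by (intro cINF_lower)
  have dB: "d n \<le> B" for n
  proof -
    obtain \<phi> where "\<phi> \<in> C n" using ne by blast
    then show ?thesis using d_le[of \<phi> n] bdd[OF C0, of \<phi> n] by (simp add: q_def)
  qed
  have dmono: "d n \<le> d m" if "n \<le> m" for n m
    unfolding d_def by (rule cINF_superset_mono[OF ne bb decseqD[OF dec that]]) auto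
  define s where "s = (SUP n. d n)"
  have ba: "bdd_above (range d)" using dB by (intro bdd_aboveI[of _ B]) auto
  have ds: "d n \<le> s" for n unfolding s_def using ba by (intro cSUP_upper) auto
  \<comment> \<open>The error is \<open>(1/4) ^ k\<close> because its square root, which governs the
    distance of neighbours, must be summable.\<close>
  define e :: "nat \<Rightarrow> real" where "e k = (1/4) ^ k" for k
  have e0: "e k > 0" for k by (simp add: e_def)
  have "\<exists>n\<ge>k. s - e k < d n" for k
  proof -
    obtain n where "s - e k < d n" using less_cSUP_iff[OF _ ba, of "s - e k"] e0[of k] unfolding s_def by auto
    then show ?thesis using dmono[of n "max n k"] by (intro exI[of _ "max n k"]) auto
  qed
  then obtain N where N: "\<And>k. N k \<ge> k" "\<And>k. s - e k < d (N k)" by metis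
  have "\<exists>\<phi>\<in>C (N k). q \<phi> < s + e k" for k
  proof -
    have "d (N k) < s + e k" using ds[of "N k"] e0[of k] by linarith
    then show ?thesis unfolding d_def using cINF_less_iff[OF ne bb] by blast
  qed
  then obtain g where g: "\<And>k. g k \<in> C (N k)" "\<And>k. q (g k) < s + e k" by metis
  have gk: "g k \<in> C k" for k using decseqD[OF dec N(1)] g(1) by blast
  have g0: "g k \<in> C 0" for k using C0 g by blast
  define h where "h k = (\<lambda>i \<omega>. (1/2) *\<^sub>R (g k i \<omega> + g (Suc k) i \<omega>))" for k
  define D where "D k i \<omega> = g (Suc k) i \<omega> - g k i \<omega>" for k i \<omega>
  \<comment> \<open>Midpoints stay in the larger of the two neighbouring sets, whose minimum already
    exceeds \<open>s - e k\<close>. The parallelogram law then gives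
    \<open>2(s + e) + 2(s + e) - 4(s - e) = 8 e\<close>.\<close>
  have h: "h k \<in> C 0" "q (h k) > s - e k" for k
  proof -
    let ?m = "min (N k) (N (Suc k))"
    have "g k \<in> C ?m" "g (Suc k) \<in> C ?m"       using g(1) decseqD[OF dec, of ?m "N k"] decseqD[OF dec, of ?m "N (Suc k)"] by auto
    then have hm: "h k \<in> C ?m" unfolding h_def by (rule mid)
    then show "h k \<in> C 0" by (rule C0)
    have "e (Suc k) \<le> e k" by (simp add: e_def)
    then have "s - e k < d ?m" using N(2)[of k] N(2)[of "Suc k"] by (auto simp: min_def)
    then show "q (h k) > s - e k" using d_le[OF hm] by linarith
  qed
  have par: "(norm (D k i \<omega>))\<^sup>2 = 2 * (norm (g k i \<omega>))\<^sup>2 + 2 * (norm (g (Suc k) i \<omega>))\<^sup>2 - 4 * (norm (h k i \<omega>))\<^sup>2" for k i \<omega>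
    unfolding D_def h_def
    by (simp add: power2_norm_eq_inner inner_add_left inner_add_right inner_diff_left inner_diff_right inner_commute field_simps)
  have Dsq: "integrable M (\<lambda>\<omega>. (norm (D k i \<omega>))\<^sup>2)" if "i \<in> I" for k i
    unfolding par using sq[OF g0 that] sq[OF h(1) that] by (intro Bochner_Integration.integrable_add Bochner_Integration.integrable_diff integrable_mult_right)
  have "q (D k) = 2 * q (g k) + 2 * q (g (Suc k)) - 4 * q (h k)" for k
    unfolding q_def sum_distrib_left sum.distrib[symmetric] sum_subtractf[symmetric]
  proof (intro sum.cong refl)
    fix i assume "i \<in> I"
    note [simp] = sq[OF g0 this] sq[OF h(1) this]
    show "(\<integral>\<omega>. (norm (D k i \<omega>))\<^sup>2 \<partial>M) = 2 * (\<integral>\<omega>. (norm (g k i \<omega>))\<^sup>2 \<partial>M) + 2 * (\<integral>\<omega>. (norm (g (Suc k) i \<omega>))\<^sup>2 \<partial>M) - 4 * (\<integral>\<omega>. (norm (h k i \<omega>))\<^sup>2 \<partial>M)"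
      unfolding par by simp
  qed
  moreover have "e (Suc k) \<le> e k" for k by (simp add: e_def)
  ultimately have qD: "q (D k) \<le> 8 * e k" for k
    using g(2)[of k] g(2)[of "Suc k"] h(2)[of k] by (smt (verit))
  have "AE \<omega> in M. convergent (\<lambda>k. g k i \<omega>)" if i: "i \<in> I" for i
  proof (rule AE_convergent_if_summable_increments)
    define a :: "nat \<Rightarrow> real" where "a k = (1/2) ^ k" for k
    have a0: "a k > 0" for k by (simp add: a_def)
    have ea: "e k = a k * a k" for k by (simp add: e_def a_def power_mult_distrib[symmetric])
    \<comment> \<open>Elementary passage from squares to first powers:
      \<open>r \<le> a + r^2 / a\<close>. With squared norms of order \<open>a k * a k\<close> both
      terms are of order \<open>a k\<close> after integration.\<close>
    have le: "norm (D k i \<omega>) \<le> a k + (norm (D k i \<omega>))\<^sup>2 / a k" for k \<omega>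
    proof (cases "norm (D k i \<omega>) \<le> a k")
      case False
      then have "norm (D k i \<omega>) * a k \<le> (norm (D k i \<omega>))\<^sup>2" by (simp add: power2_eq_square mult_left_mono)
      then have "norm (D k i \<omega>) \<le> (norm (D k i \<omega>))\<^sup>2 / a k" using a0[of k] by (simp add: field_simps)
      then show ?thesis using a0[of k] by linarith
    qed (use a0[of k] in \<open>simp add: add_increasing2\<close>)
    have int2: "integrable M (\<lambda>\<omega>. a k + (norm (D k i \<omega>))\<^sup>2 / a k)" for k using Dsq[OF i] by simp
    have Dm: "D k i \<in> borel_measurable M" for k
      unfolding D_def using meas[OF g0 i] by (intro borel_measurable_diff)
    show int: "integrable M (\<lambda>\<omega>. g (Suc k) i \<omega> - g k i \<omega>)" for k
      unfolding D_def[symmetric]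
      by (rule Bochner_Integration.integrable_bound[OF int2[of k] Dm]) (use le a0 in \<open>auto intro!: AE_I2 order_trans[OF le]\<close>)
    show "(\<integral>\<omega>. norm (g (Suc k) i \<omega> - g k i \<omega>) \<partial>M) \<le> (measure M (space M) + 8) * a k" for k
    proof -
      have "(\<integral>\<omega>. (norm (D k i \<omega>))\<^sup>2 \<partial>M) \<le> q (D k)"
        unfolding q_def using I i by (intro member_le_sum) auto
      then have D8: "(\<integral>\<omega>. (norm (D k i \<omega>))\<^sup>2 \<partial>M) \<le> 8 * (a k * a k)" using qD[of k] ea by simp
      have "(\<integral>\<omega>. norm (D k i \<omega>) \<partial>M) \<le> (\<integral>\<omega>. a k + (norm (D k i \<omega>))\<^sup>2 / a k \<partial>M)"
        using int[of k] by (intro integral_mono int2 le integrable_norm) (simp add: D_def)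
      also have "\<dots> = measure M (space M) * a k + (\<integral>\<omega>. (norm (D k i \<omega>))\<^sup>2 \<partial>M) / a k"
        using Dsq[OF i, of k] by simp
      also have "\<dots> \<le> measure M (space M) * a k + 8 * (a k * a k) / a k"
        using D8 a0[of k] by (intro add_mono divide_right_mono) auto
      also have "\<dots> = (measure M (space M) + 8) * a k" using a0[of k] by (simp add: field_simps)
      finally show ?thesis by (simp add: D_def)
    qed
    show "summable (\<lambda>k. (measure M (space M) + 8) * a k)" unfolding a_def by (intro summable_mult summable_geometric) simp
  qed
  then have "AE \<omega> in M. \<forall>i\<in>I. convergent (\<lambda>k. g k i \<omega>)" using I by (simp add: AE_finite_all)
  then show ?thesis using gk that by blast
qed

section \<open>The market\<close>

lemma wealth_step: "1 \<le> t \<Longrightarrow> wealth S w \<phi> t \<omega> = wealth S w \<phi> (t - 1) \<omega> + \<phi> t \<omega> \<bullet> incr S t \<omega>"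
  by (cases t) (auto simp: wealth_def)

lemma wealth_0 [simp]: "wealth S w \<phi> 0 \<omega> = w"
  by (simp add: wealth_def)

lemma wealth_midpoint:
  "wealth S w (\<lambda>t \<omega>. (1/2) *\<^sub>R (\<phi> t \<omega> + \<psi> t \<omega>)) t \<omega> = 1/2 * wealth S w \<phi> t \<omega> + 1/2 * wealth S w \<psi> t \<omega>"
proof -
  have "(\<Sum>s\<in>{1..t}. ((1/2) *\<^sub>R (\<phi> s \<omega> + \<psi> s \<omega>)) \<bullet> incr S s \<omega>)
      = 1/2 * (\<Sum>s\<in>{1..t}. \<phi> s \<omega> \<bullet> incr S s \<omega>) + 1/2 * (\<Sum>s\<in>{1..t}. \<psi> s \<omega> \<bullet> incr S s \<omega>)"
    unfolding sum_distrib_left sum.distrib[symmetric] by (intro sum.cong) (auto simp: inner_add_left)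
  moreover have "w + (1/2 * a + 1/2 * b) = 1/2 * (w + a) + 1/2 * (w + b)" for a b :: real by (simp add: field_simps)
  ultimately show ?thesis unfolding wealth_def by (simp only:)
qed

lemma wealth_tendsto:
  assumes "\<And>s. s \<in> {1..t} \<Longrightarrow> (\<lambda>k. g k s \<omega>) \<longlonglongrightarrow> \<phi> s \<omega>"
  shows "(\<lambda>k. wealth S w (g k) t \<omega>) \<longlonglongrightarrow> wealth S w \<phi> t \<omega>"
  unfolding wealth_def using assms by (intro tendsto_intros) auto

lemma ext_expectation_cong_AE:
  assumes "AE \<omega> in M. X \<omega> = Y \<omega>"
  shows "ext_expectation M X = ext_expectation M Y"
proof -
  have "(\<integral>\<^sup>+ \<omega>. e2ennreal (X \<omega>) \<partial>M) = (\<integral>\<^sup>+ \<omega>. e2ennreal (Y \<omega>) \<partial>M)"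
    by (rule nn_integral_cong_AE) (use assms in \<open>eventually_elim, simp\<close>)
  moreover have "(\<integral>\<^sup>+ \<omega>. e2ennreal (- X \<omega>) \<partial>M) = (\<integral>\<^sup>+ \<omega>. e2ennreal (- Y \<omega>) \<partial>M)"
    by (rule nn_integral_cong_AE) (use assms in \<open>eventually_elim, simp\<close>)
  ultimately show ?thesis by (simp add: ext_expectation_def)
qed

text \<open>Only the market enters here, so the bounds on strategies hold uniformly over
  utilities.\<close>

locale robust_market =
  fixes M :: "'a measure" and F :: "nat \<Rightarrow> 'a measure" and T :: nat
    and SS :: "(nat \<Rightarrow> 'a \<Rightarrow> 'd::euclidean_space) set" and w0 :: real
    and S' :: "nat \<Rightarrow> 'a \<Rightarrow> 'd" and \<beta> \<kappa> :: "nat \<Rightarrow> 'a \<Rightarrow> real"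
  assumes fps: "filtered_prob_space M F T"
    and SS_adapted: "\<forall>S\<in>SS. adapted F T S"
    and w0_pos: "w0 > 0"
    and Sst: "S' \<in> Sstar M F T SS"
    and beta_meas: "\<forall>t\<in>{1..T}. \<beta> t \<in> borel_measurable (F (t - 1))"
    and beta_pos: "\<forall>t\<in>{1..T}. AE \<omega> in M. \<beta> t \<omega> > 0"
    and kappa_pos: "\<forall>t\<in>{1..T}. AE \<omega> in M. \<kappa> t \<omega> > 0"
    and ess_cond: "\<forall>t\<in>{1..T}. AE \<omega> in M. Dset M F S' t \<omega> \<noteq> {0} \<longrightarrow>
        ess_inf_fam M
          (\<lambda>\<xi> \<omega>. ereal (cond_prob M (F (t - 1))
              {\<omega>'\<in>space M. \<xi> \<omega>' \<bullet> incr S' t \<omega>' \<le> - \<beta> t \<omega>' * norm (\<xi> \<omega>')} \<omega>))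
          (Xi M F S' t) \<omega>
        \<ge> ereal (\<kappa> t \<omega>)"
    and beta_W: "\<forall>t\<in>{1..T}. (\<lambda>\<omega>. 1 / \<beta> t \<omega>) \<in> Wclass M F T"
    and incr_W: "\<forall>S\<in>SS. \<forall>t\<in>{1..T}. (\<lambda>\<omega>. norm (incr S t \<omega>)) \<in> Wclass M F T"
begin

sublocale prob_space M using filtered_prob_spaceD(1)[OF fps] .

lemma S'_in: "S' \<in> SS" and S'_NA: "NA M F T S'"
  and Dset_subset: "\<And>S t. S \<in> SS \<Longrightarrow> t \<in> {1..T} \<Longrightarrow> AE \<omega> in M. Dset M F S t \<omega> \<subseteq> Dset M F S' t \<omega>"
  using Sst by (auto simp: Sstar_def)

lemma sub: "t \<le> T \<Longrightarrow> subalgebra M (F t)"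
  using filtered_prob_spaceD(2)[OF fps] .

lemma F_mono: "f \<in> borel_measurable (F s) \<Longrightarrow> s \<le> t \<Longrightarrow> t \<le> T \<Longrightarrow> f \<in> borel_measurable (F t)"
  using measurable_from_subalg[OF filtered_prob_spaceD(3)[OF fps]] by blast

lemma F_M: "f \<in> borel_measurable (F t) \<Longrightarrow> t \<le> T \<Longrightarrow> f \<in> borel_measurable M"
  using measurable_from_subalg[OF sub] by blast

lemma incr_F: "S \<in> SS \<Longrightarrow> t \<in> {1..T} \<Longrightarrow> incr S t \<in> borel_measurable (F t)"
proof -
  assume S: "S \<in> SS" and t: "t \<in> {1..T}"
  have "S t \<in> borel_measurable (F t)" "S (t - 1) \<in> borel_measurable (F (t - 1))"
    using SS_adapted S t by (auto simp: adapted_def)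
  then have "(\<lambda>\<omega>. S t \<omega> - S (t - 1) \<omega>) \<in> borel_measurable (F t)"
    using F_mono[of "S (t - 1)" "t - 1" t] t by (intro borel_measurable_diff) auto
  then show ?thesis by (simp add: incr_def[abs_def])
qed

lemma incr_M: "S \<in> SS \<Longrightarrow> t \<in> {1..T} \<Longrightarrow> incr S t \<in> borel_measurable M"
  using F_M[OF incr_F] by auto

lemma strategy_F: "\<phi> \<in> strategies F T \<Longrightarrow> t \<in> {1..T} \<Longrightarrow> \<phi> t \<in> borel_measurable (F (t - 1))"
  by (auto simp: strategies_def)

lemma strategy_M: "\<phi> \<in> strategies F T \<Longrightarrow> t \<in> {1..T} \<Longrightarrow> \<phi> t \<in> borel_measurable M"
  by (rule F_M[OF strategy_F]) auto

lemma wealth_F: "S \<in> SS \<Longrightarrow> \<phi> \<in> strategies F T \<Longrightarrow> t \<le> T \<Longrightarrow> wealth S w \<phi> t \<in> borel_measurable (F t)"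
proof -
  assume S: "S \<in> SS" and \<phi>: "\<phi> \<in> strategies F T" and t: "t \<le> T"
  have "(\<lambda>\<omega>. \<phi> s \<omega> \<bullet> incr S s \<omega>) \<in> borel_measurable (F t)" if s: "s \<in> {1..t}" for s
  proof (rule borel_measurable_inner)
    show "\<phi> s \<in> borel_measurable (F t)" using F_mono[OF strategy_F[OF \<phi>, of s]] s t by auto
    show "incr S s \<in> borel_measurable (F t)" using F_mono[OF incr_F[OF S, of s]] s t by auto
  qed
  then show ?thesis unfolding wealth_def[abs_def] by (intro borel_measurable_add borel_measurable_sum) auto
qed

lemma wealth_M: "S \<in> SS \<Longrightarrow> \<phi> \<in> strategies F T \<Longrightarrow> t \<le> T \<Longrightarrow> wealth S w \<phi> t \<in> borel_measurable M"
  using F_M[OF wealth_F] by auto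

text \<open>Existence of a kernel is what gives the choice in \<open>rcd_incr\<close>, and with it
  \<open>Dset\<close>, its intended meaning.\<close>

lemma rcd_incr:
  assumes S: "S \<in> SS" and t: "t \<in> {1..T}"
  shows "reg_cond_distr M (F (t - 1)) (incr S t) (rcd_incr M F S t)"
proof -
  have "\<exists>k. reg_cond_distr M (F (t - 1)) (incr S t) k"
    by (rule reg_cond_distr_exists[OF prob_space_axioms sub incr_M[OF S t]]) (use t in auto)
  then show ?thesis unfolding rcd_incr_def by (rule someI_ex)
qed

section \<open>Conditional supports of the increments and projected strategies\<close>

lemma incr_in_Dset:
  assumes S: "S \<in> SS" and t: "t \<in> {1..T}"
  shows "AE \<omega> in M. incr S t \<omega> \<in> Dset M F S' t \<omega>"
proof -
  have "AE \<omega> in M. incr S t \<omega> \<in> support (rcd_incr M F S t \<omega>)"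
    by (rule AE_in_support_reg_cond_distr[OF prob_space_axioms sub incr_M[OF S t] rcd_incr[OF S t]]) (use t in auto)
  with Dset_subset[OF S t] show ?thesis
    by eventually_elim (auto simp: Dset_def intro: hull_inc)
qed

lemma zero_in_Dset:
  assumes t: "t \<in> {1..T}"
  shows "AE \<omega> in M. 0 \<in> Dset M F S' t \<omega>"
  unfolding Dset_def
proof (rule no_arbitrage_imp_0_in_affine_hull_support[OF prob_space_axioms sub incr_M[OF S'_in t] rcd_incr[OF S'_in t]])
  fix \<xi> assume \<xi>: "\<xi> \<in> borel_measurable (F (t - 1))" and ge: "AE \<omega> in M. \<xi> \<omega> \<bullet> incr S' t \<omega> \<ge> 0"
  \<comment> \<open>Trading at the single date \<open>t\<close> turns a one-period arbitrage into
    one over the whole horizon.\<close>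
  define \<phi> where "\<phi> = (\<lambda>s. if s = t then \<xi> else (\<lambda>_. 0))"
  have "\<phi> \<in> strategies F T" using \<xi> by (auto simp: strategies_def \<phi>_def)
  moreover have "wealth S' 0 \<phi> T \<omega> = \<xi> \<omega> \<bullet> incr S' t \<omega>" for \<omega>
  proof -
    have "(\<Sum>s\<in>{1..T}. \<phi> s \<omega> \<bullet> incr S' s \<omega>) = (\<Sum>s\<in>{1..T}. if s = t then \<xi> \<omega> \<bullet> incr S' t \<omega> else 0)"
      by (intro sum.cong) (auto simp: \<phi>_def)
    then show ?thesis using t by (simp add: wealth_def)
  qed
  ultimately show "AE \<omega> in M. \<xi> \<omega> \<bullet> incr S' t \<omega> = 0" using S'_NA[unfolded NA_def, rule_format, of \<phi>] ge by simp
qed (use t in auto)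

text \<open>The projection preserves inner products with every vector of \<open>Dset\<close>, not
  merely with the increments of \<open>S'\<close>. So one \<open>\<psi>\<close>, chosen from
  \<open>S'\<close> alone, serves all models, although the null set may vary with the model.\<close>

lemma strategy_projection:
  assumes \<phi>: "\<phi> \<in> strategies F T"
  shows "\<exists>\<psi>\<in>strategies F T. (\<forall>t\<in>{1..T}. AE \<omega> in M. \<psi> t \<omega> \<in> Dset M F S' t \<omega>) \<and>
    (\<forall>S\<in>SS. \<forall>w. AE \<omega> in M. \<forall>t\<le>T. wealth S w \<psi> t \<omega> = wealth S w \<phi> t \<omega>)"
proof -
  define P where "P t \<psi> \<longleftrightarrow> \<psi> \<in> borel_measurable (F (t - 1)) \<and> (AE \<omega> in M. \<psi> \<omega> \<in> Dset M F S' t \<omega>) \<and>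
    (AE \<omega> in M. \<forall>x\<in>Dset M F S' t \<omega>. \<psi> \<omega> \<bullet> x = \<phi> t \<omega> \<bullet> x)" for t \<psi>
  have "\<exists>\<psi>. P t \<psi>" if t: "t \<in> {1..T}" for t
  proof -
    have "t - 1 \<le> T" using t by auto
    from predictable_projection[OF prob_space_axioms sub[OF this] incr_M[OF S'_in t] rcd_incr[OF S'_in t]
        zero_in_Dset[OF t, unfolded Dset_def] strategy_F[OF \<phi> t], folded Dset_def]
    show ?thesis unfolding P_def by blast
  qed
  then obtain \<psi> where "\<forall>t\<in>{1..T}. P t (\<psi> t)" using bchoice[of "{1..T}" P] by blast
  then have \<psi>: "\<And>t. t \<in> {1..T} \<Longrightarrow> \<psi> t \<in> borel_measurable (F (t - 1))"
    "\<And>t. t \<in> {1..T} \<Longrightarrow> AE \<omega> in M. \<psi> t \<omega> \<in> Dset M F S' t \<omega>"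
    "\<And>t. t \<in> {1..T} \<Longrightarrow> AE \<omega> in M. \<forall>x\<in>Dset M F S' t \<omega>. \<psi> t \<omega> \<bullet> x = \<phi> t \<omega> \<bullet> x"
    unfolding P_def by blast+
  show ?thesis
  proof (intro bexI[of _ \<psi>] conjI ballI allI \<psi>(2))
    show "\<psi> \<in> strategies F T" using \<psi>(1) by (auto simp: strategies_def)
    fix S w assume S: "S \<in> SS"
    have "AE \<omega> in M. \<forall>t\<in>{1..T}. \<psi> t \<omega> \<bullet> incr S t \<omega> = \<phi> t \<omega> \<bullet> incr S t \<omega>"
    proof (rule AE_finite_allI)
      fix t assume t: "t \<in> {1..T}"
      show "AE \<omega> in M. \<psi> t \<omega> \<bullet> incr S t \<omega> = \<phi> t \<omega> \<bullet> incr S t \<omega>"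
        using \<psi>(3)[OF t] incr_in_Dset[OF S t] by eventually_elim auto
    qed simp
    then show "AE \<omega> in M. \<forall>t\<le>T. wealth S w \<psi> t \<omega> = wealth S w \<phi> t \<omega>"
      by eventually_elim (auto simp: wealth_def intro!: sum.cong)
  qed
qed

section \<open>Uniform bounds on positions and wealth\<close>

lemma cond_prob_lower_bound:
  assumes t: "t \<in> {1..T}" and \<xi>: "\<xi> \<in> Xi M F S' t"
  shows "AE \<omega> in M. Dset M F S' t \<omega> \<noteq> {0} \<longrightarrow>
    \<kappa> t \<omega> \<le> cond_prob M (F (t - 1)) {\<omega>'\<in>space M. \<xi> \<omega>' \<bullet> incr S' t \<omega>' \<le> - \<beta> t \<omega>' * norm (\<xi> \<omega>')} \<omega>"
proof -
  have tT: "t - 1 \<le> T" using t by auto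
  interpret G: finite_measure_subalgebra M "F (t - 1)" by standard (rule sub[OF tT])
  let ?Y = "\<lambda>\<xi> \<omega>. ereal (cond_prob M (F (t - 1)) {\<omega>'\<in>space M. \<xi> \<omega>' \<bullet> incr S' t \<omega>' \<le> - \<beta> t \<omega>' * norm (\<xi> \<omega>')} \<omega>)"
  \<comment> \<open>Conditional probabilities lie in \<open>[0,1]\<close> almost surely, which
    supplies the bounds required for the existence of the essential infimum.\<close>
  have "AE \<omega> in M. ess_inf_fam M ?Y (Xi M F S' t) \<omega> \<le> ?Y \<xi> \<omega>"
  proof (rule ess_inf_fam_le[OF prob_space_axioms \<xi>])
    fix \<xi> assume \<xi>: "\<xi> \<in> Xi M F S' t"
    let ?A = "{\<omega>'\<in>space M. \<xi> \<omega>' \<bullet> incr S' t \<omega>' \<le> - \<beta> t \<omega>' * norm (\<xi> \<omega>')}"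
    have "\<xi> \<in> borel_measurable (F (t - 1))" using \<xi> by (simp add: Xi_def)
    note [measurable] = F_M[OF this tT] F_M[OF beta_meas[rule_format, OF t] tT] incr_M[OF S'_in t]
    have [measurable]: "?A \<in> sets M" by measurable
    have ind: "integrable M (indicator ?A :: 'a \<Rightarrow> real)" by (simp add: integrable_indicator_iff less_top[symmetric])
    show "?Y \<xi> \<in> borel_measurable M" unfolding cond_prob_def by measurable
    have "AE \<omega> in M. real_cond_exp M (F (t - 1)) (indicator ?A) \<omega> \<ge> 0"
      by (rule G.real_cond_exp_pos) auto
    then show "AE \<omega> in M. 0 \<le> ?Y \<xi> \<omega>" unfolding cond_prob_def by eventually_elim simp
    have "AE \<omega> in M. real_cond_exp M (F (t - 1)) (indicator ?A) \<omega> \<le> 1"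
      by (rule G.real_cond_exp_le_c[OF ind]) (auto simp: indicator_def)
    then show "AE \<omega> in M. ?Y \<xi> \<omega> \<le> 1" unfolding cond_prob_def by eventually_elim simp
  qed
  moreover have "AE \<omega> in M. Dset M F S' t \<omega> \<noteq> {0} \<longrightarrow> ereal (\<kappa> t \<omega>) \<le> ess_inf_fam M ?Y (Xi M F S' t) \<omega>"
    using ess_cond t by blast
  ultimately show ?thesis
  proof eventually_elim
    case (elim \<omega>)
    show ?case
    proof
      assume "Dset M F S' t \<omega> \<noteq> {0}"
      with elim(2) have "ereal (\<kappa> t \<omega>) \<le> ess_inf_fam M ?Y (Xi M F S' t) \<omega>" by blast
      also note elim(1)
      finally show "\<kappa> t \<omega> \<le> cond_prob M (F (t - 1)) {\<omega>'\<in>space M. \<xi> \<omega>' \<bullet> incr S' t \<omega>' \<le> - \<beta> t \<omega>' * norm (\<xi> \<omega>')} \<omega>"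
        by (simp only: ereal_less_eq)
    qed
  qed
qed

text \<open>On the event \<open>E\<close>, where the inequality fails, \<open>?A\<close> would make
  the wealth at \<open>t\<close> negative, so \<open>E\<close> and \<open>?A\<close> are almost
  surely disjoint. As \<open>E\<close> is known at \<open>t - 1\<close>, the conditional probability
  of \<open>?A\<close> vanishes on \<open>E\<close>, against the lower bound
  \<open>\<kappa> t > 0\<close>.\<close>

lemma strategy_bound:
  assumes \<phi>: "\<phi> \<in> admissible M F T SS w0" and t: "t \<in> {1..T}" and D: "AE \<omega> in M. \<phi> t \<omega> \<in> Dset M F S' t \<omega>"
  shows "AE \<omega> in M. \<beta> t \<omega> * norm (\<phi> t \<omega>) \<le> wealth S' w0 \<phi> (t - 1) \<omega>"
proof -
  have tT: "t - 1 \<le> T" "t \<le> T" using t by auto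
  interpret G: finite_measure_subalgebra M "F (t - 1)" by standard (rule sub[OF tT(1)])
  have st: "\<phi> \<in> strategies F T" and adm: "\<And>s. s \<le> T \<Longrightarrow> AE \<omega> in M. wealth S' w0 \<phi> s \<omega> \<ge> 0"
    using \<phi> S'_in by (auto simp: admissible_def)
  define W where "W = wealth S' w0 \<phi> (t - 1)"
  have \<xi>: "\<phi> t \<in> Xi M F S' t" using strategy_F[OF st t] D by (simp add: Xi_def)
  let ?A = "{\<omega>'\<in>space M. \<phi> t \<omega>' \<bullet> incr S' t \<omega>' \<le> - \<beta> t \<omega>' * norm (\<phi> t \<omega>')}"
  let ?cp = "real_cond_exp M (F (t - 1)) (indicator ?A)"
  define E where "E = {\<omega>\<in>space (F (t - 1)). W \<omega> < \<beta> t \<omega> * norm (\<phi> t \<omega>)}"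
  have mF[measurable]: "\<phi> t \<in> borel_measurable (F (t - 1))" "\<beta> t \<in> borel_measurable (F (t - 1))" "W \<in> borel_measurable (F (t - 1))"
    using strategy_F[OF st t] beta_meas t wealth_F[OF S'_in st tT(1)] by (auto simp: W_def)
  note [measurable] = mF[THEN F_M[OF _ tT(1)]] incr_M[OF S'_in t]
  have E: "E \<in> sets (F (t - 1))" unfolding E_def by measurable
  then have EM[measurable]: "E \<in> sets M" using sub[OF tT(1)] by (auto simp: subalgebra_def)
  have [measurable]: "?A \<in> sets M" by measurable
  have ind: "integrable M (indicator ?A :: 'a \<Rightarrow> real)" by (simp add: integrable_indicator_iff less_top[symmetric])
  have cp0: "AE \<omega> in M. ?cp \<omega> \<ge> 0" by (rule G.real_cond_exp_pos) auto
  have "AE \<omega> in M. indicator E \<omega> * indicator ?A \<omega> = (0::real)"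
    using adm[OF tT(2)]
  proof eventually_elim
    case (elim \<omega>)
    then show ?case using wealth_step[of t S' w0 \<phi> \<omega>] t by (auto simp: E_def W_def indicator_def)
  qed
  then have "(\<integral>\<omega>. indicator E \<omega> * indicator ?A \<omega> \<partial>M) = (0::real)" by (rule integral_eq_zero_AE)
  moreover have "(\<integral>\<omega>. indicator E \<omega> * indicator ?A \<omega> \<partial>M) = (\<integral>\<omega>. indicator E \<omega> * ?cp \<omega> \<partial>M)"
    using G.real_cond_exp_intA[OF ind E] by (simp add: set_lebesgue_integral_def)
  ultimately have "(\<integral>\<omega>. indicator E \<omega> * ?cp \<omega> \<partial>M) = 0" by simp
  moreover have "AE \<omega> in M. 0 \<le> indicator E \<omega> * ?cp \<omega>" using cp0 by eventually_elim simp
  moreover have "integrable M (\<lambda>\<omega>. indicator E \<omega> * ?cp \<omega>)"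
    using integrable_real_mult_indicator[OF EM G.real_cond_exp_int(1)[OF ind]] by (simp add: mult.commute)
  ultimately have "AE \<omega> in M. indicator E \<omega> * ?cp \<omega> = 0" by (simp add: integral_nonneg_eq_0_iff_AE)
  moreover have "AE \<omega> in M. \<beta> t \<omega> > 0" "AE \<omega> in M. \<kappa> t \<omega> > 0" using beta_pos kappa_pos t by auto
  ultimately show ?thesis
    using cond_prob_lower_bound[OF t \<xi>] adm[OF tT(1)] D AE_space
  proof eventually_elim
    case (elim \<omega>)
    show ?case
    proof (rule ccontr)
      assume "\<not> ?thesis"
      then have *: "W \<omega> < \<beta> t \<omega> * norm (\<phi> t \<omega>)" by (simp add: W_def)
      then have "\<omega> \<in> E" using elim sub[OF tT(1)] by (auto simp: E_def subalgebra_def)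
      then have "?cp \<omega> = 0" using elim by simp
      \<comment> \<open>Nonnegative previous wealth forces a nonzero position on \<open>E\<close>;
        since the position lies in \<open>Dset\<close>, the exceptional case
        \<open>Dset = {0}\<close> cannot occur there.\<close>
      have "0 < \<beta> t \<omega> * norm (\<phi> t \<omega>)" using * elim by (simp add: W_def)
      then have "\<phi> t \<omega> \<noteq> 0" by auto
      then have "Dset M F S' t \<omega> \<noteq> {0}" using elim by auto
      then show False using elim \<open>?cp \<omega> = 0\<close> by (simp add: cond_prob_def)
    qed
  qed
qed

text \<open>Solves the recursion in which each period multiplies wealth by at most
  \<open>1 + norm (incr S' s) / \<beta> s\<close>; as a finite product it inherits all
  moments.\<close>

definition wealth_bound :: "nat \<Rightarrow> 'a \<Rightarrow> real" where
  "wealth_bound t \<omega> = w0 * (\<Prod>s\<in>{1..t}. 1 + norm (incr S' s \<omega>) * (1 / \<beta> s \<omega>))"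

definition position_bound :: "nat \<Rightarrow> 'a \<Rightarrow> real" where
  "position_bound t \<omega> = wealth_bound (t - 1) \<omega> * (1 / \<beta> t \<omega>)"

lemma wealth_bound_Wclass: "t \<le> T \<Longrightarrow> wealth_bound t \<in> Wclass M F T"
  unfolding wealth_bound_def[abs_def] using beta_W incr_W S'_in
  by (intro Wclass_mult[OF fps] Wclass_prod[OF fps] Wclass_add[OF fps] Wclass_const[OF fps]) auto

lemma position_bound_Wclass: "t \<in> {1..T} \<Longrightarrow> position_bound t \<in> Wclass M F T"
  unfolding position_bound_def[abs_def] using beta_W
  by (intro Wclass_mult[OF fps] wealth_bound_Wclass) auto

text \<open>Position and wealth bounds alternate: the wealth under \<open>S'\<close> at
  \<open>t - 1\<close> limits the position at \<open>t\<close>, which limits the wealth at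
  \<open>t\<close>. The result mentions \<open>S'\<close> only, so it applies to positions whatever
  model is then evaluated.\<close>

lemma position_bound:
  assumes \<phi>: "\<phi> \<in> admissible M F T SS w0" and D: "\<And>t. t \<in> {1..T} \<Longrightarrow> AE \<omega> in M. \<phi> t \<omega> \<in> Dset M F S' t \<omega>"
  shows "AE \<omega> in M. \<forall>t\<in>{1..T}. norm (\<phi> t \<omega>) \<le> position_bound t \<omega>"
proof -
  have "AE \<omega> in M. \<forall>t\<in>{1..T}. \<beta> t \<omega> > 0 \<and> \<beta> t \<omega> * norm (\<phi> t \<omega>) \<le> wealth S' w0 \<phi> (t - 1) \<omega>"
  proof (rule AE_finite_allI)
    fix t assume t: "t \<in> {1..T}"
    have "AE \<omega> in M. \<beta> t \<omega> > 0" using beta_pos t by auto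
    with strategy_bound[OF \<phi> t D[OF t]]
    show "AE \<omega> in M. \<beta> t \<omega> > 0 \<and> \<beta> t \<omega> * norm (\<phi> t \<omega>) \<le> wealth S' w0 \<phi> (t - 1) \<omega>"
      by eventually_elim simp
  qed simp
  then show ?thesis
  proof eventually_elim
    case (elim \<omega>)
    have pos: "norm (\<phi> t \<omega>) \<le> wealth S' w0 \<phi> (t - 1) \<omega> * (1 / \<beta> t \<omega>)" if "t \<in> {1..T}" for t
    proof -
      have "\<beta> t \<omega> > 0" "\<beta> t \<omega> * norm (\<phi> t \<omega>) \<le> wealth S' w0 \<phi> (t - 1) \<omega>" using elim that by auto
      then show ?thesis by (simp add: pos_le_divide_eq mult.commute)
    qed
    have W: "wealth S' w0 \<phi> t \<omega> \<le> wealth_bound t \<omega>" if "t \<le> T" for t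
      using that
    proof (induction t)
      case 0
      then show ?case by (simp add: wealth_bound_def)
    next
      case (Suc t)
      let ?W = "wealth S' w0 \<phi> t \<omega>" and ?x = "norm (incr S' (Suc t) \<omega>)"
      have b: "\<beta> (Suc t) \<omega> > 0" using elim Suc.prems by auto
      have "wealth S' w0 \<phi> (Suc t) \<omega> = ?W + \<phi> (Suc t) \<omega> \<bullet> incr S' (Suc t) \<omega>" using wealth_step[of "Suc t" S'] by simp
      also have "\<dots> \<le> ?W + norm (\<phi> (Suc t) \<omega>) * ?x" using norm_cauchy_schwarz by auto
      also have "\<dots> \<le> ?W + ?W * (1 / \<beta> (Suc t) \<omega>) * ?x"
        using pos[of "Suc t"] Suc.prems by (intro add_left_mono mult_right_mono) auto
      also have "\<dots> = ?W * (1 + ?x * (1 / \<beta> (Suc t) \<omega>))" by (simp add: algebra_simps)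
      also have "\<dots> \<le> wealth_bound t \<omega> * (1 + ?x * (1 / \<beta> (Suc t) \<omega>))"
        using Suc b by (intro mult_right_mono) auto
      also have "\<dots> = wealth_bound (Suc t) \<omega>" by (simp add: wealth_bound_def)
      finally show ?case .
    qed
    show ?case
    proof
      fix t assume t: "t \<in> {1..T}"
      have "norm (\<phi> t \<omega>) \<le> wealth S' w0 \<phi> (t - 1) \<omega> * (1 / \<beta> t \<omega>)" using pos[OF t] .
      also have "\<dots> \<le> position_bound t \<omega>" unfolding position_bound_def
        using W[of "t - 1"] elim t by (intro mult_right_mono) (auto simp: less_imp_le)
      finally show "norm (\<phi> t \<omega>) \<le> position_bound t \<omega>" .
    qed
  qed
qed

text \<open>The norm bound is recorded in place of membership in \<open>Dset\<close>: it passes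
  directly to midpoints and almost sure limits and gives the domination.\<close>

definition bounded_admissible :: "(nat \<Rightarrow> 'a \<Rightarrow> 'd) set" where
  "bounded_admissible = {\<phi>\<in>admissible M F T SS w0. AE \<omega> in M. \<forall>t\<in>{1..T}. norm (\<phi> t \<omega>) \<le> position_bound t \<omega>}"

text \<open>Allows the supremum to be sought among bounded strategies, since projection alters no
  expected utility.\<close>

lemma bounded_admissible_representative:
  assumes \<phi>: "\<phi> \<in> admissible M F T SS w0"
  obtains \<psi> where "\<psi> \<in> bounded_admissible" "robust_value M SS T U w0 \<psi> = robust_value M SS T U w0 \<phi>"
proof -
  have st: "\<phi> \<in> strategies F T" using \<phi> by (auto simp: admissible_def)
  obtain \<psi> where \<psi>: "\<psi> \<in> strategies F T" "\<And>t. t \<in> {1..T} \<Longrightarrow> AE \<omega> in M. \<psi> t \<omega> \<in> Dset M F S' t \<omega>"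
    and W: "\<And>S w. S \<in> SS \<Longrightarrow> AE \<omega> in M. \<forall>t\<le>T. wealth S w \<psi> t \<omega> = wealth S w \<phi> t \<omega>"
    using strategy_projection[OF st] by blast
  have adm: "\<psi> \<in> admissible M F T SS w0"
    unfolding admissible_def
  proof (intro CollectI conjI \<psi>(1) ballI allI impI)
    fix S t assume S: "S \<in> SS" and t: "t \<le> T"
    have "AE \<omega> in M. wealth S w0 \<phi> t \<omega> \<ge> 0" using \<phi> S t by (auto simp: admissible_def)
    with W[OF S, of w0] show "AE \<omega> in M. wealth S w0 \<psi> t \<omega> \<ge> 0" by eventually_elim (use t in auto)
  qed
  then have "\<psi> \<in> bounded_admissible" using position_bound[OF adm \<psi>(2)] by (simp add: bounded_admissible_def)
  moreover have "robust_value M SS T U w0 \<psi> = robust_value M SS T U w0 \<phi>"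
    unfolding robust_value_def
  proof (intro INF_cong refl ext_expectation_cong_AE)
    fix S assume S: "S \<in> SS"
    show "AE \<omega> in M. U (wealth S w0 \<psi> T \<omega>) = U (wealth S w0 \<phi> T \<omega>)"
      using W[OF S, of w0] by eventually_elim simp
  qed
  ultimately show ?thesis using that by blast
qed

lemma bounded_admissible_midpoint:
  assumes \<phi>: "\<phi> \<in> bounded_admissible" and \<psi>: "\<psi> \<in> bounded_admissible"
  shows "(\<lambda>t \<omega>. (1/2) *\<^sub>R (\<phi> t \<omega> + \<psi> t \<omega>)) \<in> bounded_admissible"
  unfolding bounded_admissible_def admissible_def strategies_def
proof (intro CollectI conjI ballI allI impI)
  fix t assume t: "t \<in> {1..T}"
  then show "(\<lambda>\<omega>. (1/2) *\<^sub>R (\<phi> t \<omega> + \<psi> t \<omega>)) \<in> borel_measurable (F (t - 1))"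
    using strategy_F[OF _ t, of \<phi>] strategy_F[OF _ t, of \<psi>] \<phi> \<psi>
    by (intro borel_measurable_scaleR borel_measurable_add borel_measurable_const) (auto simp: bounded_admissible_def admissible_def)
next
  fix S t assume "S \<in> SS" "t \<le> T"
  then have "AE \<omega> in M. wealth S w0 \<phi> t \<omega> \<ge> 0" "AE \<omega> in M. wealth S w0 \<psi> t \<omega> \<ge> 0"
    using \<phi> \<psi> by (auto simp: bounded_admissible_def admissible_def)
  then show "AE \<omega> in M. wealth S w0 (\<lambda>t \<omega>. (1/2) *\<^sub>R (\<phi> t \<omega> + \<psi> t \<omega>)) t \<omega> \<ge> 0"
    unfolding wealth_midpoint by eventually_elim simp
next
  have "AE \<omega> in M. \<forall>t\<in>{1..T}. norm (\<phi> t \<omega>) \<le> position_bound t \<omega>" "AE \<omega> in M. \<forall>t\<in>{1..T}. norm (\<psi> t \<omega>) \<le> position_bound t \<omega>"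
    using \<phi> \<psi> by (auto simp: bounded_admissible_def)
  then show "AE \<omega> in M. \<forall>t\<in>{1..T}. norm ((1/2) *\<^sub>R (\<phi> t \<omega> + \<psi> t \<omega>)) \<le> position_bound t \<omega>"
  proof eventually_elim
    case (elim \<omega>)
    show ?case
    proof
      fix t assume "t \<in> {1..T}"
      then have "norm (\<phi> t \<omega>) \<le> position_bound t \<omega>" "norm (\<psi> t \<omega>) \<le> position_bound t \<omega>" using elim by auto
      then show "norm ((1/2) *\<^sub>R (\<phi> t \<omega> + \<psi> t \<omega>)) \<le> position_bound t \<omega>" using norm_triangle_ineq[of "\<phi> t \<omega>" "\<psi> t \<omega>"] by simp
    qed
  qed
qed

text \<open>The absolute value gives nonnegativity at every \<open>\<omega>\<close>, whereas
  \<open>position_bound\<close> has a known sign only almost surely.\<close>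

definition terminal_bound :: "(nat \<Rightarrow> 'a \<Rightarrow> 'd) \<Rightarrow> 'a \<Rightarrow> real" where
  "terminal_bound S \<omega> = w0 + (\<Sum>t\<in>{1..T}. \<bar>position_bound t \<omega> * norm (incr S t \<omega>)\<bar>)"

lemma terminal_bound_nonneg: "0 \<le> terminal_bound S \<omega>"
  unfolding terminal_bound_def using w0_pos by (intro add_nonneg_nonneg sum_nonneg) auto

lemma terminal_bound_integrable: "S \<in> SS \<Longrightarrow> integrable M (terminal_bound S)"
  unfolding terminal_bound_def[abs_def] using incr_W
  by (intro Bochner_Integration.integrable_add Bochner_Integration.integrable_sum integrable_abs integrable_const
      Wclass_integrable[OF fps] Wclass_mult[OF fps] position_bound_Wclass) auto

lemma wealth_le_terminal_bound:
  assumes "AE \<omega> in M. \<forall>t\<in>{1..T}. norm (\<phi> t \<omega>) \<le> position_bound t \<omega>"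
  shows "AE \<omega> in M. wealth S w0 \<phi> T \<omega> \<le> terminal_bound S \<omega>"
  using assms
proof eventually_elim
  case (elim \<omega>)
  show ?case unfolding wealth_def terminal_bound_def
  proof (intro add_left_mono sum_mono)
    fix t assume "t \<in> {1..T}"
    then have "\<phi> t \<omega> \<bullet> incr S t \<omega> \<le> position_bound t \<omega> * norm (incr S t \<omega>)"
      using elim by (intro order_trans[OF norm_cauchy_schwarz] mult_right_mono) auto
    then show "\<phi> t \<omega> \<bullet> incr S t \<omega> \<le> \<bar>position_bound t \<omega> * norm (incr S t \<omega>)\<bar>" by linarith
  qed
qed

end

section \<open>Existence of an optimal strategy\<close>

theorem theorem3p3:
  fixes M :: "'a measure" and F :: "nat \<Rightarrow> 'a measure" and T :: nat
    and SS :: "(nat \<Rightarrow> 'a \<Rightarrow> 'd::euclidean_space) set"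
    and U :: "real \<Rightarrow> ereal" and w0 :: real
  assumes fps: "filtered_prob_space M F T"
    and SS_ne: "SS \<noteq> {}"
    and SS_adapted: "\<forall>S\<in>SS. adapted F T S"
    and w0_pos: "w0 > 0"
    and utility: "utility_assumption U"
    and dom_U: "interior {x. U x > - \<infinity>} = {0<..}"
    and Sst: "S' \<in> Sstar M F T SS"
    and beta_meas: "\<forall>t\<in>{1..T}. \<beta> t \<in> borel_measurable (F (t - 1))"
    and beta_pos: "\<forall>t\<in>{1..T}. AE \<omega> in M. \<beta> t \<omega> > 0"
    and kappa_meas: "\<forall>t\<in>{1..T}. \<kappa> t \<in> borel_measurable (F (t - 1))"
    and kappa_pos: "\<forall>t\<in>{1..T}. AE \<omega> in M. \<kappa> t \<omega> > 0"
    and ess_cond: "\<forall>t\<in>{1..T}. AE \<omega> in M. Dset M F S' t \<omega> \<noteq> {0} \<longrightarrow>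
        ess_inf_fam M
          (\<lambda>\<xi> \<omega>. ereal (cond_prob M (F (t - 1))
              {\<omega>'\<in>space M. \<xi> \<omega>' \<bullet> incr S' t \<omega>' \<le> - \<beta> t \<omega>' * norm (\<xi> \<omega>')} \<omega>))
          (Xi M F S' t) \<omega>
        \<ge> ereal (\<kappa> t \<omega>)"
    and beta_W: "\<forall>t\<in>{1..T}. (\<lambda>\<omega>. 1 / \<beta> t \<omega>) \<in> Wclass M F T"
    and incr_W: "\<forall>S\<in>SS. \<forall>t\<in>{1..T}. (\<lambda>\<omega>. norm (incr S t \<omega>)) \<in> Wclass M F T"
  shows "\<exists>\<phi>\<in>admissible M F T SS w0.
           value_fun M F T SS U w0 = robust_value M SS T U w0 \<phi> \<and>
           value_fun M F T SS U w0 < \<infinity>"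
proof -
  interpret robust_market M F T SS w0 S' \<beta> \<kappa>
    by unfold_locales (fact fps SS_adapted w0_pos Sst beta_meas beta_pos kappa_pos ess_cond beta_W incr_W)+
  obtain a b where ab: "0 \<le> a" "0 \<le> b" and Uab: "\<And>x. 0 \<le> x \<Longrightarrow> U x \<le> ereal (a + b * x)"
    using utility_linear_bound[OF utility dom_U] by metis
  have mono_U: "mono U" and concave_U: "concave_ext U" and usc_U: "usc U"
    using utility by (auto simp: utility_assumption_def)
  define J where "J = robust_value M SS T U w0"
  define V where "V = value_fun M F T SS U w0"
  have V: "V = Sup (J ` admissible M F T SS w0)" by (simp add: V_def value_fun_def J_def)
  define X where "X S \<phi> \<omega> = U (wealth S w0 \<phi> T \<omega>)" for S \<phi> :: "nat \<Rightarrow> 'a \<Rightarrow> 'd" and \<omega>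
  have J: "c \<le> J \<phi> \<longleftrightarrow> (\<forall>S\<in>SS. c \<le> ext_expectation M (X S \<phi>))" for c \<phi>
    by (simp add: J_def robust_value_def X_def[abs_def] le_INF_iff)
  \<comment> \<open>The majorant depends on the model but not on the strategy, as domination along a
    sequence of strategies requires.\<close>
  define L where "L S \<omega> = a + b * terminal_bound S \<omega>" for S \<omega>
  have L: "integrable M (L S)" "0 \<le> L S \<omega>" if "S \<in> SS" for S \<omega>
    unfolding L_def using terminal_bound_integrable[OF that] ab terminal_bound_nonneg by auto
  have X_meas: "X S \<phi> \<in> borel_measurable M" if "S \<in> SS" "\<phi> \<in> bounded_admissible" for S \<phi>
    unfolding X_def using that wealth_M[of S \<phi> T]
    by (intro measurable_compose[OF _ usc_borel_measurable[OF usc_U]]) (auto simp: bounded_admissible_def admissible_def)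
  have X_le: "AE \<omega> in M. X S \<phi> \<omega> \<le> ereal (L S \<omega>)" if S: "S \<in> SS" and \<phi>: "\<phi> \<in> bounded_admissible" for S \<phi>
  proof -
    have "AE \<omega> in M. wealth S w0 \<phi> T \<omega> \<le> terminal_bound S \<omega>"
      using \<phi> by (intro wealth_le_terminal_bound) (simp add: bounded_admissible_def)
    then show ?thesis
    proof eventually_elim
      case (elim \<omega>)
      have "X S \<phi> \<omega> \<le> U (terminal_bound S \<omega>)" unfolding X_def using elim by (rule monoD[OF mono_U])
      also have "\<dots> \<le> ereal (L S \<omega>)" unfolding L_def by (rule Uab[OF terminal_bound_nonneg])
      finally show ?case .
    qed
  qed
  have V_fin: "V < \<infinity>"
  proof -
    \<comment> \<open>The robust value is an infimum over models, so any one model bounds it from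
      above.\<close>
    obtain S where S: "S \<in> SS" using SS_ne by auto
    have "J \<phi> \<le> ereal (\<integral>\<omega>. L S \<omega> \<partial>M)" if adm: "\<phi> \<in> admissible M F T SS w0" for \<phi>
    proof -
      obtain \<psi> where \<psi>: "\<psi> \<in> bounded_admissible" "J \<psi> = J \<phi>"
        using bounded_admissible_representative[OF adm, of U] unfolding J_def by metis
      have "J \<psi> \<le> ext_expectation M (X S \<psi>)" using J S by blast
      also have "\<dots> \<le> ereal (\<integral>\<omega>. L S \<omega> \<partial>M)"
        by (rule ext_expectation_dominated_le[OF X_meas[OF S \<psi>(1)] L[OF S] X_le[OF S \<psi>(1)]])
      finally show ?thesis using \<psi>(2) by simp
    qed
    then have "V \<le> ereal (\<integral>\<omega>. L S \<omega> \<partial>M)" unfolding V by (intro Sup_least) auto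
    then show ?thesis by (rule le_less_trans) simp
  qed
  \<comment> \<open>The strategy that never trades keeps the wealth at \<open>w0 > 0\<close>, so the
    supremum is over a nonempty set and is approached by an increasing sequence of attained
    values.\<close>
  have "(\<lambda>_ _. 0) \<in> admissible M F T SS w0"
    using w0_pos by (auto simp: admissible_def strategies_def wealth_def)
  then have "J ` admissible M F T SS w0 \<noteq> {}" by auto
  from Sup_countable_SUP[OF this] obtain c :: "nat \<Rightarrow> ereal"
    where c: "incseq c" "range c \<subseteq> J ` admissible M F T SS w0" "V = (SUP n. c n)" unfolding V by auto
  \<comment> \<open>Each \<open>c n\<close> is an attained value and bounded representatives keep
    the value, so \<open>C n\<close> is nonempty even with a weak inequality.\<close>
  define C where "C n = {\<phi>\<in>bounded_admissible. c n \<le> J \<phi>}" for n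
  have bounded: "AE \<omega> in M. \<forall>t\<in>{1..T}. norm (\<phi> t \<omega>) \<le> position_bound t \<omega>" "\<phi> \<in> strategies F T"
    if "\<phi> \<in> bounded_admissible" for \<phi>
    using that by (auto simp: bounded_admissible_def admissible_def)
  have pb_sq: "integrable M (\<lambda>\<omega>. (position_bound t \<omega>)\<^sup>2)" if "t \<in> {1..T}" for t
    unfolding power2_eq_square
    by (rule Wclass_integrable[OF fps Wclass_mult[OF fps position_bound_Wclass[OF that] position_bound_Wclass[OF that]]])
  have sq_le: "AE \<omega> in M. (norm (\<phi> t \<omega>))\<^sup>2 \<le> (position_bound t \<omega>)\<^sup>2" if "\<phi> \<in> bounded_admissible" "t \<in> {1..T}" for \<phi> t
    using bounded(1)[OF that(1)] by eventually_elim (use that(2) in \<open>auto intro: power_mono\<close>)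
  have sq: "integrable M (\<lambda>\<omega>. (norm (\<phi> t \<omega>))\<^sup>2)" if "\<phi> \<in> bounded_admissible" "t \<in> {1..T}" for \<phi> t
  proof (rule Bochner_Integration.integrable_bound[OF pb_sq[OF that(2)]])
    show "(\<lambda>\<omega>. (norm (\<phi> t \<omega>))\<^sup>2) \<in> borel_measurable M"
      using strategy_M[OF bounded(2)[OF that(1)] that(2)] by measurable
    show "AE \<omega> in M. norm ((norm (\<phi> t \<omega>))\<^sup>2) \<le> norm ((position_bound t \<omega>)\<^sup>2)"
      using sq_le[OF that] by eventually_elim simp
  qed
  obtain g where gC: "\<And>k. g k \<in> C k" and g_conv: "AE \<omega> in M. \<forall>t\<in>{1..T}. convergent (\<lambda>k. g k t \<omega>)"
  proof (rule almost_minimizers_converge_AE[of M "{1..T}" C "\<Sum>t\<in>{1..T}. \<integral>\<omega>. (position_bound t \<omega>)\<^sup>2 \<partial>M"])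
    show "finite_measure M" by (rule finite_measure_axioms)
    show "decseq C"
      unfolding decseq_def C_def using incseqD[OF c(1)] by (auto intro: order_trans)
    show "C n \<noteq> {}" for n
    proof -
      have "c n \<in> J ` admissible M F T SS w0" using c(2) by auto
      then obtain \<phi> where \<phi>: "\<phi> \<in> admissible M F T SS w0" "c n = J \<phi>" by auto
      then obtain \<psi> where "\<psi> \<in> bounded_admissible" "J \<psi> = J \<phi>"
        using bounded_admissible_representative[OF \<phi>(1), of U] unfolding J_def by metis
      then show ?thesis using \<phi>(2) unfolding C_def by auto
    qed
    show "\<phi> t \<in> borel_measurable M" if "\<phi> \<in> C 0" "t \<in> {1..T}" for \<phi> t
      using strategy_M[OF bounded(2) that(2)] that(1) by (auto simp: C_def)
    show "integrable M (\<lambda>\<omega>. (norm (\<phi> t \<omega>))\<^sup>2)" if "\<phi> \<in> C 0" "t \<in> {1..T}" for \<phi> t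
      using sq[OF _ that(2)] that(1) by (auto simp: C_def)
    show "(\<Sum>t\<in>{1..T}. \<integral>\<omega>. (norm (\<phi> t \<omega>))\<^sup>2 \<partial>M) \<le> (\<Sum>t\<in>{1..T}. \<integral>\<omega>. (position_bound t \<omega>)\<^sup>2 \<partial>M)" if "\<phi> \<in> C 0" for \<phi>
    proof (rule sum_mono)
      fix t assume t: "t \<in> {1..T}"
      have \<phi>: "\<phi> \<in> bounded_admissible" using that by (simp add: C_def)
      show "(\<integral>\<omega>. (norm (\<phi> t \<omega>))\<^sup>2 \<partial>M) \<le> (\<integral>\<omega>. (position_bound t \<omega>)\<^sup>2 \<partial>M)"
        by (rule integral_mono_AE[OF sq[OF \<phi> t] pb_sq[OF t] sq_le[OF \<phi> t]])
    qed
    show "(\<lambda>t \<omega>. (1/2) *\<^sub>R (\<phi> t \<omega> + \<psi> t \<omega>)) \<in> C n" if \<phi>: "\<phi> \<in> C n" and \<psi>: "\<psi> \<in> C n" for n \<phi> \<psi>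
    proof -
      let ?m = "\<lambda>t \<omega>. (1/2) *\<^sub>R (\<phi> t \<omega> + \<psi> t \<omega>)"
      have b: "\<phi> \<in> bounded_admissible" "\<psi> \<in> bounded_admissible" "?m \<in> bounded_admissible"
        using \<phi> \<psi> bounded_admissible_midpoint by (auto simp: C_def)
      have "c n \<le> ext_expectation M (X S ?m)" if S: "S \<in> SS" for S
      proof (rule ext_expectation_midpoint[OF X_meas[OF S b(1)] X_le[OF S b(1)] X_meas[OF S b(2)] X_le[OF S b(2)]
            X_meas[OF S b(3)] X_le[OF S b(3)] L[OF S]])
        show "AE \<omega> in M. ereal (1/2) * X S \<phi> \<omega> + ereal (1/2) * X S \<psi> \<omega> \<le> X S ?m \<omega>"
        proof (rule AE_I2)
          fix \<omega>
          show "ereal (1/2) * X S \<phi> \<omega> + ereal (1/2) * X S \<psi> \<omega> \<le> X S ?m \<omega>"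
            using concave_U[unfolded concave_ext_def, rule_format, of "1/2" "wealth S w0 \<phi> T \<omega>" "wealth S w0 \<psi> T \<omega>"]
            unfolding X_def wealth_midpoint by simp
        qed
        show "c n \<le> ext_expectation M (X S \<phi>)" "c n \<le> ext_expectation M (X S \<psi>)"
          using \<phi> \<psi> S unfolding C_def J by auto
      qed
      then show ?thesis using b(3) unfolding C_def J by auto
    qed
    fix g assume "\<And>k. g k \<in> C k" "AE \<omega> in M. \<forall>t\<in>{1..T}. convergent (\<lambda>k. g k t \<omega>)"
    then show thesis by (rule that)
  qed simp
  have g: "g k \<in> bounded_admissible" "c k \<le> J (g k)" for k using gC[of k] by (auto simp: C_def)
  \<comment> \<open>The pointwise \<open>lim\<close> has an arbitrary value where the sequence
    diverges, but as a limit of functions measurable at \<open>t - 1\<close> it is predictable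
    without any modification on null sets.\<close>
  define \<phi> where "\<phi> t \<omega> = lim (\<lambda>k. g k t \<omega>)" for t \<omega>
  have lim: "AE \<omega> in M. \<forall>t\<in>{1..T}. (\<lambda>k. g k t \<omega>) \<longlonglongrightarrow> \<phi> t \<omega>"
    using g_conv by eventually_elim (auto simp: \<phi>_def convergent_LIMSEQ_iff)
  have lim_W: "AE \<omega> in M. \<forall>t\<le>T. (\<lambda>k. wealth S w0 (g k) t \<omega>) \<longlonglongrightarrow> wealth S w0 \<phi> t \<omega>" for S
    using lim by eventually_elim (auto intro!: wealth_tendsto)
  have \<phi>_st: "\<phi> \<in> strategies F T"
    unfolding strategies_def
  proof (intro CollectI ballI)
    fix t assume t: "t \<in> {1..T}"
    show "\<phi> t \<in> borel_measurable (F (t - 1))"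
      unfolding \<phi>_def using strategy_F[OF bounded(2)[OF g(1)] t] by (rule borel_measurable_lim_metric)
  qed
  have "AE \<omega> in M. wealth S w0 \<phi> t \<omega> \<ge> 0" if S: "S \<in> SS" and t: "t \<le> T" for S t
  proof -
    have "AE \<omega> in M. \<forall>k. wealth S w0 (g k) t \<omega> \<ge> 0"
      using g(1) S t unfolding AE_all_countable by (auto simp: bounded_admissible_def admissible_def)
    with lim_W[of S] show ?thesis
    proof eventually_elim
      case (elim \<omega>)
      show ?case by (rule LIMSEQ_le_const[of "\<lambda>k. wealth S w0 (g k) t \<omega>"]) (use elim t in auto)
    qed
  qed
  then have \<phi>_adm: "\<phi> \<in> admissible M F T SS w0" using \<phi>_st by (simp add: admissible_def)
  have "AE \<omega> in M. \<forall>k. \<forall>t\<in>{1..T}. norm (g k t \<omega>) \<le> position_bound t \<omega>"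
    unfolding AE_all_countable using bounded(1)[OF g(1)] by blast
  with lim have "AE \<omega> in M. \<forall>t\<in>{1..T}. norm (\<phi> t \<omega>) \<le> position_bound t \<omega>"
  proof eventually_elim
    case (elim \<omega>)
    show ?case
    proof
      fix t assume t: "t \<in> {1..T}"
      show "norm (\<phi> t \<omega>) \<le> position_bound t \<omega>"
        by (rule Lim_norm_ubound[of sequentially "\<lambda>k. g k t \<omega>"]) (use elim t in auto)
    qed
  qed
  then have \<phi>: "\<phi> \<in> bounded_admissible" using \<phi>_adm by (simp add: bounded_admissible_def)
  have "c m \<le> J \<phi>" for m
    unfolding J
  proof
    fix S assume S: "S \<in> SS"
    show "c m \<le> ext_expectation M (X S \<phi>)"
    \<comment> \<open>With \<open>m\<close> fixed, all later \<open>g k\<close> have robust value at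
      least \<open>c m\<close>, and this bound survives the limit. Only afterwards is the supremum
      over \<open>m\<close> taken.\<close>
    proof (rule ext_expectation_fatou[OF X_meas[OF S g(1)] X_le[OF S g(1)] X_meas[OF S \<phi>] X_le[OF S \<phi>] L[OF S]])
      show "AE \<omega> in M. \<forall>d>X S \<phi> \<omega>. \<forall>\<^sub>F k in sequentially. X S (g k) \<omega> < d"
        using lim_W[of S] by eventually_elim (auto simp: X_def intro: usc_tendsto_less[OF usc_U])
      fix k assume "m \<le> k"
      then have "c m \<le> c k" using incseqD[OF c(1)] by blast
      also have "\<dots> \<le> ext_expectation M (X S (g k))" using g(2)[of k] S unfolding J by blast
      finally show "c m \<le> ext_expectation M (X S (g k))" .
    qed
  qed
  then have "V \<le> J \<phi>" unfolding c(3) by (rule SUP_least)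
  moreover have "J \<phi> \<le> V" unfolding V using \<phi>_adm by (intro Sup_upper) auto
  ultimately have "V = J \<phi>" by (rule antisym)
  then show ?thesis using \<phi>_adm V_fin unfolding V_def J_def by blast
qed

end
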